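(* Let $n\geq1$ and let $\vec{p_1}=(p_{11},\dots,p_{1n})$, $\vec{p_2}=(p_{21},\dots,p_{2n})$, $\vec{q}=(q_1,\dots,q_n)$ satisfy, for every $i=1,\dots,n$: $1<p_{1i}<\infty$, $1<q_i<\infty$, $p_{1i}'<p_{2i}<\infty$ (where $p_{1i}'=\frac{p_{1i}}{p_{1i}-1}$), and $\frac{1}{q_i}=\frac{1}{p_{1i}}+\frac{1}{p_{2i}}$. Let $\lambda,\lambda_1,\lambda_2\in\mathbb{R}$ satisfy $-\frac{1}{n}\sum_{i=1}^{n}\frac{1}{q_i}<\lambda<0$, $0\leq\lambda_2<\frac{1}{n}$ and $\lambda=\lambda_1+\lambda_2$. If $b\in\mathrm{CBMO}^{\vec{p_2},\lambda_2}(\mathbb{R}^n)$, then $\mathcal{H}^*_b$ is bounded from $\mathcal{B}^{\vec{p_1},\lambda_1}(\mathbb{R}^n)$ to $\mathcal{B}^{\vec{q},\lambda}(\mathbb{R}^n)$, and there is a constant $C>0$ independent of $b$ and $f$ such that for all $f\in\mathcal{B}^{\vec{p_1},\lambda_1}(\mathbb{R}^n)$ $$\|\mathcal{H}^*_bf\|_{\mathcal{B}^{\vec{q},\lambda}(\mathbb{R}^n)}\leq C\,\|b\|_{\mathrm{CBMO}^{\vec{p_2},\lambda_2}(\mathbb{R}^n)}\|f\|_{\mathcal{B}^{\vec{p_1},\lambda_1}(\mathbb{R}^n)}.$$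
   Context: Functions are complex-valued Lebesgue measurable functions on $\mathbb{R}^n$; $B(0,r)$ is the Euclidean ball centered at the origin with radius $r$; $|E|$ is the Lebesgue measure and $\chi_E$ the characteristic function of $E$. Mixed Lebesgue space: for $\vec{p}=(p_1,\dots,p_n)$ with $0<p_i<\infty$, $$\|f\|_{L^{\vec{p}}(\mathbb{R}^n)}=\Bigg(\int_{\mathbb{R}}\cdots\bigg(\int_{\mathbb{R}}\Big(\int_{\mathbb{R}}|f(x_1,x_2,\dots,x_n)|^{p_1}dx_1\Big)^{\frac{p_2}{p_1}}dx_2\bigg)^{\frac{p_3}{p_2}}\cdots dx_n\Bigg)^{\frac{1}{p_n}},$$ and $L^{\vec{p}}(\mathbb{R}^n)$ is the set of measurable $f$ with $\|f\|_{L^{\vec{p}}(\mathbb{R}^n)}<\infty$. Mixed $\lambda$-central bounded mean oscillation space: for $\vec{q}$ with $1<q_i<\infty$ for all $i$ and $\lambda<\frac1n$, $\mathrm{CBMO}^{\vec{q},\lambda}(\mathbb{R}^n)$ is the set of measurable $f$ with $$\|f\|_{\mathrm{CBMO}^{\vec{q},\lambda}(\mathbb{R}^n)}=\sup_{r>0}\frac{\|(f-f_{B(0,r)})\chi_{B(0,r)}\|_{L^{\vec{q}}(\mathbb{R}^n)}}{|B(0,r)|^{\lambda}\|\chi_{B(0,r)}\|_{L^{\vec{q}}(\mathbb{R}^n)}}<\infty,\qquad f_{B(0,r)}=\frac{1}{|B(0,r)|}\int_{B(0,r)}f(t)\,dt.$$ Mixed $\lambda$-central Morrey space: for $\vec{q}$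 with $1<q_i<\infty$ for all $i$ and $\lambda\in\mathbb{R}$, $\mathcal{B}^{\vec{q},\lambda}(\mathbb{R}^n)$ is the set of measurable $f$ with $$\|f\|_{\mathcal{B}^{\vec{q},\lambda}(\mathbb{R}^n)}=\sup_{r>0}\frac{\|f\chi_{B(0,r)}\|_{L^{\vec{q}}(\mathbb{R}^n)}}{|B(0,r)|^{\lambda}\|\chi_{B(0,r)}\|_{L^{\vec{q}}(\mathbb{R}^n)}}<\infty.$$ Dual Hardy operator: $\mathcal{H}^*f(x)=\int_{|t|\geq|x|}\frac{f(t)}{|t|^n}\,dt$ for $x\in\mathbb{R}^n\setminus\{0\}$. Its commutator with a locally integrable function $b$ is $\mathcal{H}^*_bf=b\,\mathcal{H}^*f-\mathcal{H}^*(fb)$, i.e. $\mathcal{H}^*_bf(x)=\int_{|t|\geq|x|}\frac{(b(x)-b(t))f(t)}{|t|^n}\,dt$. *)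

theory Defs
  imports "HOL-Analysis.Analysis"
begin

text \<open>
  The library has no real powers on \<^typ>\<open>ennreal\<close>. This definition is meant for exponents \<open>a > 0\<close>,
  so \<open>\<infinity>\<close> is sent to \<open>\<infinity>\<close>.
\<close>

definition ennreal_powr :: "ennreal \<Rightarrow> real \<Rightarrow> ennreal"  (infixr \<open>powr\<^sub>e\<close> 80)
  where "x powr\<^sub>e a = (if x = \<infinity> then \<infinity> else ennreal (enn2real x powr a))"

text \<open>
  \<open>\<real>\<^sup>n\<close> is \<^typ>\<open>real ^ 'n\<close> for a finite, linearly ordered index type \<open>'n\<close>. The linear order matters
  because the mixed norm depends on the order of integration: the coordinates \<open>x\<^sub>1, \<dots>, x\<^sub>n\<close> are the
  coordinates at the elements of \<open>'n\<close> listed increasingly.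

  One step replaces \<open>F\<close> by its \<open>L\<^bsup>p\<^sub>i\<^esup>\<close>-norm in the coordinate \<open>i\<close> (the result no longer depends on
  that coordinate). The list gives the coordinates from the innermost to the outermost. As
  \<open>(G powr\<^sub>e (1/p\<^sub>i)) powr\<^sub>e p\<^sub>j = G powr\<^sub>e (p\<^sub>j/p\<^sub>i)\<close>, composing the steps gives the iterated integral
  with inner exponents \<open>p\<^sub>2/p\<^sub>1, p\<^sub>3/p\<^sub>2, \<dots>\<close> and last exponent \<open>1/p\<^sub>n\<close>.
\<close>

fun iterated_norm ::
  "real ^ 'n \<Rightarrow> 'n list \<Rightarrow> (real ^ 'n \<Rightarrow> ennreal) \<Rightarrow> real ^ 'n \<Rightarrow> ennreal" where
  "iterated_norm p [] F = F"
| "iterated_norm p (i # is) F =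
     iterated_norm p is
       (\<lambda>x. (\<integral>\<^sup>+ s. F (\<chi> j. if j = i then s else x $ j) powr\<^sub>e (p $ i) \<partial>lebesgue) powr\<^sub>e (1 / p $ i))"

text \<open>
  After all coordinates have been integrated out the function is constant; it is evaluated at \<open>0\<close>.
\<close>

definition mixed_norm :: "real ^ 'n::{finite,linorder} \<Rightarrow> (real ^ 'n::{finite,linorder} \<Rightarrow> complex) \<Rightarrow> ennreal" where
  "mixed_norm p f = iterated_norm p (sorted_list_of_set UNIV) (\<lambda>x. ennreal (norm (f x))) 0"

definition ball_average :: "(real ^ 'n \<Rightarrow> complex) \<Rightarrow> real \<Rightarrow> complex" where
  "ball_average f r =
     (1 / measure lebesgue (ball (0 :: real ^ 'n) r)) *\<^sub>R (LINT t:ball 0 r|lebesgue. f t)"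

text \<open>
  The Bochner integral of a non-integrable function is \<open>0\<close>. This does not enlarge the following
  space: if all \<open>q\<^sub>i > 1\<close> and \<open>(f - c) \<chi>\<^bsub>B(0,r)\<^esub>\<close> has finite mixed norm for some constant \<open>c\<close>, then \<open>f\<close> is
  integrable on \<open>B(0,r)\<close> by Hoelder's inequality. So a measurable \<open>f\<close> with finite seminorm is locally
  integrable.
\<close>

definition cbmo_norm ::
  "real ^ 'n::{finite,linorder} \<Rightarrow> real \<Rightarrow> (real ^ 'n::{finite,linorder} \<Rightarrow> complex) \<Rightarrow> ennreal" where
  "cbmo_norm q l f =
     (SUP r\<in>{0<..}.
        mixed_norm q (\<lambda>x. (f x - ball_average f r) * indicator (ball 0 r) x)
        / (ennreal (measure lebesgue (ball (0 :: real ^ 'n::{finite,linorder}) r) powr l)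
           * mixed_norm q (indicator (ball 0 r))))"

definition cbmo_space ::
  "real ^ 'n::{finite,linorder} \<Rightarrow> real \<Rightarrow> (real ^ 'n::{finite,linorder} \<Rightarrow> complex) set" where
  "cbmo_space q l = {f \<in> borel_measurable lebesgue. cbmo_norm q l f < \<infinity>}"

definition central_morrey_norm ::
  "real ^ 'n::{finite,linorder} \<Rightarrow> real \<Rightarrow> (real ^ 'n::{finite,linorder} \<Rightarrow> complex) \<Rightarrow> ennreal" where
  "central_morrey_norm q l f =
     (SUP r\<in>{0<..}.
        mixed_norm q (\<lambda>x. f x * indicator (ball 0 r) x)
        / (ennreal (measure lebesgue (ball (0 :: real ^ 'n::{finite,linorder}) r) powr l)
           * mixed_norm q (indicator (ball 0 r))))"

definition central_morrey_space ::
  "real ^ 'n::{finite,linorder} \<Rightarrow> real \<Rightarrow> (real ^ 'n::{finite,linorder} \<Rightarrow> complex) set" where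
  "central_morrey_space q l = {f \<in> borel_measurable lebesgue. central_morrey_norm q l f < \<infinity>}"

text \<open>
  The dual Hardy operator is only meaningful at points \<open>x \<noteq> 0\<close> where the integral converges
  absolutely. The (conventional) value at \<open>0\<close> does not affect any of the norms above.
\<close>

definition dual_hardy_defined_at :: "(real ^ 'n \<Rightarrow> complex) \<Rightarrow> real ^ 'n \<Rightarrow> bool" where
  "dual_hardy_defined_at f x \<longleftrightarrow>
     set_integrable lebesgue {t. norm t \<ge> norm x} (\<lambda>t. f t / of_real (norm t ^ CARD('n)))"

definition dual_hardy :: "(real ^ 'n \<Rightarrow> complex) \<Rightarrow> real ^ 'n \<Rightarrow> complex" where
  "dual_hardy f x =
     (LINT t:{t. norm t \<ge> norm x}|lebesgue. f t / of_real (norm t ^ CARD('n)))"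

definition dual_hardy_commutator ::
  "(real ^ 'n \<Rightarrow> complex) \<Rightarrow> (real ^ 'n \<Rightarrow> complex) \<Rightarrow> real ^ 'n \<Rightarrow> complex" where
  "dual_hardy_commutator b f x = b x * dual_hardy f x - dual_hardy (\<lambda>t. f t * b t) x"

end

theory Submission
  imports Defs
begin

text \<open>
  On a dyadic shell \<open>\<rho>/2 \<le> |x| < \<rho>\<close> the commutator is at most \<open>|b x - b\<^bsub>B(0,\<rho>)\<^esub>| I + J\<close>, where
  \<open>I\<close> and \<open>J\<close> are the integrals of \<open>|f t| / |t|\<^sup>n\<close> and \<open>|b t - b\<^bsub>B(0,\<rho>)\<^esub>| |f t| / |t|\<^sup>n\<close> over
  \<open>|t| \<ge> \<rho>/2\<close>. Splitting these over the balls \<open>B(0, 2\<^sup>j \<rho>)\<close>, Hoelder's inequality bounds each piece by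
  its natural power of the radius; replacing \<open>b\<^bsub>B(0,\<rho>)\<^esub>\<close> by the average over the larger ball costs a
  factor \<open>j\<close>, and the series converges because \<open>\<lambda> < 0\<close>. The mixed norm over \<open>B(0,r)\<close> is then summed
  over the shells \<open>\<rho> = 2\<^bsup>-m\<^esup> r\<close> by Minkowski's inequality, and this geometric series converges
  because \<open>n \<lambda> + \<Sum> 1/q\<^sub>i > 0\<close>.

  Sections of a Lebesgue measurable function need not be measurable, so the inequalities for iterated
  norms are proved for Borel functions and carried over along almost everywhere equality.
\<close>

text \<open>Write \<open>e1 = n * l1\<close>, \<open>e2 = n * l2\<close> and \<open>s\<close> for
  the sum of the \<open>1 / q $ i\<close>. Almost all estimates have the form
  \<open>X \<le> ennreal (const * r powr e) * K\<close>, where \<open>K\<close> is built from the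
  two norms, so only the exponent \<open>e\<close> has to be followed. A ball has
  \<open>p\<close>-norm of order \<open>r\<close> to the power of the sum of the
  \<open>1 / p $ i\<close>, which makes these sums cancel in every mean value. Three signs then
  decide convergence: \<open>e1 < 0\<close> for the first outer integral, \<open>e1 + e2 < 0\<close>
  for the second, and \<open>e1 + e2 + s > 0\<close> for the shells shrinking to the origin. The
  sign \<open>l2 \<ge> 0\<close> enters through the averages of \<open>b\<close>: the change between
  consecutive dyadic radii is then controlled by the largest radius.

  The commutator does not change when a constant is added to \<open>b\<close>, so any constant may
  be subtracted. Using the average at the radius of the current shell puts the whole drift of the
  averages into the outer integral; the sum over the shells meets none. The outer integrals are
  estimated in \<open>ennreal\<close>, and their finiteness then yields absolute convergence at
  every nonzero point.\<close>

section \<open>Real powers of extended nonnegative reals\<close>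

lemma ennreal_powr_top [simp]: "top powr\<^sub>e a = top"
  by (simp add: ennreal_powr_def)

lemma ennreal_powr_ennreal [simp]: "0 \<le> x \<Longrightarrow> ennreal x powr\<^sub>e a = ennreal (x powr a)"
  by (simp add: ennreal_powr_def)

lemma ennreal_powr_zero [simp]: "0 powr\<^sub>e a = 0"
  by (simp add: ennreal_powr_def)

lemma ennreal_powr_one [simp]: "x powr\<^sub>e 1 = x"
  by (cases x) simp_all

lemma ennreal_powr_eq_0_iff [simp]: "x powr\<^sub>e a = 0 \<longleftrightarrow> x = 0"
  by (cases x) (auto simp: ennreal_eq_0_iff)

lemma ennreal_powr_eq_top_iff [simp]: "x powr\<^sub>e a = top \<longleftrightarrow> x = top"
  by (cases x) simp_all

lemma ennreal_powr_less_top_iff [simp]: "x powr\<^sub>e a < top \<longleftrightarrow> x < top"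
  by (simp add: less_top[symmetric])

lemma one_ennreal_powr [simp]: "1 powr\<^sub>e a = 1"
  by (simp add: ennreal_powr_def)

lemma ennreal_powr_mult:
  assumes "0 < a"
  shows "(x * y) powr\<^sub>e a = x powr\<^sub>e a * y powr\<^sub>e a"
proof (cases "x = top \<or> y = top")
  case True
  then show ?thesis
    by (auto simp: ennreal_mult_eq_top_iff ennreal_top_mult ennreal_mult_top)
next
  case False
  then obtain r s where "x = ennreal r" "0 \<le> r" "y = ennreal s" "0 \<le> s"
    by (metis ennreal_cases)
  then show ?thesis
    by (simp add: powr_mult flip: ennreal_mult)
qed

lemma ennreal_powr_powr: "(x powr\<^sub>e a) powr\<^sub>e b = x powr\<^sub>e (a * b)"
  by (cases x) (simp_all add: powr_powr)

lemma ennreal_powr_add: "x powr\<^sub>e a * x powr\<^sub>e b = x powr\<^sub>e (a + b)"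
  by (cases x) (simp_all add: powr_add ennreal_mult_top flip: ennreal_mult)

lemma ennreal_powr_mono:
  assumes "0 < a" "x \<le> y"
  shows "x powr\<^sub>e a \<le> y powr\<^sub>e a"
  using assms by (cases x; cases y) (auto intro!: ennreal_leI powr_mono2 simp: top_unique)

lemma ennreal_powr_le_imp_le:
  assumes "0 < a" "x powr\<^sub>e a \<le> y powr\<^sub>e a"
  shows "x \<le> y"
  using ennreal_powr_mono[of "1 / a", OF _ assms(2)] assms(1) by (simp add: ennreal_powr_powr)

lemma borel_measurable_ennreal_powr [measurable (raw)]:
  assumes [measurable]: "f \<in> borel_measurable M"
  shows "(\<lambda>x. f x powr\<^sub>e a) \<in> borel_measurable M"
  unfolding ennreal_powr_def by measurable

section \<open>Young, Hoelder and Minkowski inequalities in one variable\<close>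

lemma ennreal_powr_young:
  assumes "0 < q" "0 < p1" "0 < p2" "1 / q = 1 / p1 + 1 / p2"
  shows "(x * y) powr\<^sub>e q \<le> ennreal (q / p1) * x powr\<^sub>e p1 + ennreal (q / p2) * y powr\<^sub>e p2"
proof (cases "x = 0 \<or> y = 0 \<or> x = top \<or> y = top")
  \<comment> \<open>A zero factor kills the left side because \<open>0 * top = 0\<close>; otherwise
    an infinite factor makes the right side infinite, the weights being positive.\<close>
  case True
  then show ?thesis
    using assms by (auto simp: ennreal_mult_eq_top_iff ennreal_mult_top)
next
  case False
  then obtain r s where rs: "x = ennreal r" "0 < r" "y = ennreal s" "0 < s"
    by (metis ennreal_cases ennreal_0 order_le_less)
  \<comment> \<open>The weights \<open>q / p1\<close> and \<open>q / p2\<close> sum to 1, so Young's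
    inequality applies to \<open>r powr p1\<close> and \<open>s powr p2\<close>, whose weighted
    geometric mean is \<open>(r * s) powr q\<close>.\<close>
  have "q / p1 + q / p2 = q * (1 / p1 + 1 / p2)"
    by (simp add: algebra_simps)
  also have "\<dots> = 1"
    using assms(1) by (simp flip: assms(4))
  finally have "q / p1 + q / p2 = 1" .
  then have "(r powr p1) powr (q / p1) * (s powr p2) powr (q / p2)
      \<le> q / p1 * r powr p1 + q / p2 * s powr p2"
    using assms rs by (intro Youngs_inequality_0) auto
  then have "(r * s) powr q \<le> q / p1 * r powr p1 + q / p2 * s powr p2"
    using assms rs by (simp add: powr_powr powr_mult)
  then show ?thesis
    using assms rs by (simp add: flip: ennreal_mult ennreal_plus)
qed

text \<open>Dividing both functions by their norms reduces the claim to integrating Young's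
  inequality: the normalised integrals are 1 and the weights add up to 1. The measure is arbitrary,
  so the lemma serves for slices and, with the counting measure, for series.\<close>

lemma nn_integral_holder:
  assumes "0 < q" "0 < p1" "0 < p2" "1 / q = 1 / p1 + 1 / p2"
    and [measurable]: "F \<in> borel_measurable M" "G \<in> borel_measurable M"
  shows "(\<integral>\<^sup>+s. (F s * G s) powr\<^sub>e q \<partial>M) powr\<^sub>e (1 / q)
     \<le> (\<integral>\<^sup>+s. F s powr\<^sub>e p1 \<partial>M) powr\<^sub>e (1 / p1) * (\<integral>\<^sup>+s. G s powr\<^sub>e p2 \<partial>M) powr\<^sub>e (1 / p2)"
proof -
  define A where "A = (\<integral>\<^sup>+s. F s powr\<^sub>e p1 \<partial>M) powr\<^sub>e (1 / p1)"
  define B where "B = (\<integral>\<^sup>+s. G s powr\<^sub>e p2 \<partial>M) powr\<^sub>e (1 / p2)"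
  have A: "A powr\<^sub>e p1 = (\<integral>\<^sup>+s. F s powr\<^sub>e p1 \<partial>M)" and B: "B powr\<^sub>e p2 = (\<integral>\<^sup>+s. G s powr\<^sub>e p2 \<partial>M)"
    using assms(2,3) by (auto simp: A_def B_def ennreal_powr_powr)
  consider "A = 0 \<or> B = 0" | "A \<noteq> 0" "B \<noteq> 0" "A = top \<or> B = top"
    | "A \<noteq> 0" "A \<noteq> top" "B \<noteq> 0" "B \<noteq> top" by blast
  then have "(\<integral>\<^sup>+s. (F s * G s) powr\<^sub>e q \<partial>M) powr\<^sub>e (1 / q) \<le> A * B"
  proof cases
    case 1
    then have "(AE s in M. F s = 0) \<or> (AE s in M. G s = 0)"
      by (auto simp: A_def B_def nn_integral_0_iff_AE)
    then have "AE s in M. (F s * G s) powr\<^sub>e q = 0"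
      by auto
    then have "(\<integral>\<^sup>+s. (F s * G s) powr\<^sub>e q \<partial>M) = 0"
      by (simp add: nn_integral_0_iff_AE)
    then show ?thesis by simp
  next
    case 2
    then show ?thesis by (auto simp: ennreal_mult_top ennreal_top_mult)
  next
    case 3
    have cancel: "(A * B) powr\<^sub>e q * (u * v) powr\<^sub>e q = (F s * G s) powr\<^sub>e q"
      if "u = F s * inverse A" "v = G s * inverse B" for u v s
    proof -
      have "A * B * (u * v) = (F s * (A * inverse A)) * (G s * (B * inverse B))"
        by (simp add: that mult_ac)
      also have "\<dots> = F s * G s"
        using 3 by (simp add: ennreal_divide_self less_top flip: divide_ennreal_def)
      finally show ?thesis using assms(1) by (simp flip: ennreal_powr_mult)
    qed
    have norm1: "(inverse C powr\<^sub>e p) * (C powr\<^sub>e p) = 1" if "C \<noteq> 0" "C \<noteq> top" "0 < p" for C p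
    proof -
      have "inverse C * C = 1"
        using that by (simp add: ennreal_divide_self less_top mult.commute flip: divide_ennreal_def)
      then show ?thesis
        using that(3) by (simp flip: ennreal_powr_mult)
    qed
    have "(\<integral>\<^sup>+s. (F s * G s) powr\<^sub>e q \<partial>M)
        \<le> (\<integral>\<^sup>+s. (A * B) powr\<^sub>e q * (ennreal (q / p1) * (F s * inverse A) powr\<^sub>e p1
            + ennreal (q / p2) * (G s * inverse B) powr\<^sub>e p2) \<partial>M)"
      using assms(1-4) by (intro nn_integral_mono, subst cancel[OF refl refl, symmetric])
        (intro mult_left_mono ennreal_powr_young, auto)
    also have "\<dots> = (A * B) powr\<^sub>e q * (ennreal (q / p1) * (inverse A powr\<^sub>e p1 * A powr\<^sub>e p1)
            + ennreal (q / p2) * (inverse B powr\<^sub>e p2 * B powr\<^sub>e p2))"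
      unfolding A B using assms(2,3)
      by (simp add: nn_integral_cmult nn_integral_add ennreal_powr_mult nn_integral_multc mult_ac)
    also have "\<dots> = (A * B) powr\<^sub>e q * ennreal (q / p1 + q / p2)"
      using assms(1-3) 3 by (simp add: norm1)
    also have "q / p1 + q / p2 = q * (1 / p1 + 1 / p2)"
      by (simp add: algebra_simps)
    also have "\<dots> = 1"
      using assms(1) by (simp flip: assms(4))
    finally have "(\<integral>\<^sup>+s. (F s * G s) powr\<^sub>e q \<partial>M) \<le> (A * B) powr\<^sub>e q" by simp
    from ennreal_powr_mono[OF _ this, of "1 / q"] assms(1) show ?thesis
      by (simp add: ennreal_powr_powr)
  qed
  then show ?thesis by (simp add: A_def B_def)
qed

text \<open>
  Weighting the \<open>m\<close>-th term by its own norm \<open>a m\<close> and applying the discrete Hoelder inequality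
  pointwise reduces Minkowski's inequality to an exchange of sum and integral.
\<close>

lemma nn_integral_minkowski:
  assumes p: "1 < p" and [measurable]: "\<And>m. F m \<in> borel_measurable M"
  shows "(\<integral>\<^sup>+s. (\<Sum>m. F m s) powr\<^sub>e p \<partial>M) powr\<^sub>e (1 / p)
     \<le> (\<Sum>m::nat. (\<integral>\<^sup>+s. F m s powr\<^sub>e p \<partial>M) powr\<^sub>e (1 / p))"
proof -
  define a where "a m = (\<integral>\<^sup>+s. F m s powr\<^sub>e p \<partial>M) powr\<^sub>e (1 / p)" for m
  have a: "a m powr\<^sub>e p = (\<integral>\<^sup>+s. F m s powr\<^sub>e p \<partial>M)" for m
    using p by (simp add: a_def ennreal_powr_powr)
  have "(\<integral>\<^sup>+s. (\<Sum>m. F m s) powr\<^sub>e p \<partial>M) powr\<^sub>e (1 / p) \<le> (\<Sum>m. a m)"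
  proof (cases "(\<Sum>m. a m) = top")
    case False
    have fin: "a m \<noteq> top" for m
      using False ennreal_suminf_lessD less_top by blast
    define p' where "p' = p / (p - 1)"
    have p': "0 < p'" "1 / 1 = 1 / p' + 1 / p" "1 / p' = (p - 1) / p"
      using p by (auto simp: p'_def field_simps)
    define u where "u m = a m powr\<^sub>e (1 / p')" for m
    define v where "v m s = F m s * inverse (u m)" for m s
    have [measurable]: "v m \<in> borel_measurable M" for m
      unfolding v_def by measurable
    have "AE s in M. F m s = 0" if "a m = 0" for m
      using that by (auto simp: a_def nn_integral_0_iff_AE)
    \<comment> \<open>For \<open>a m = 0\<close> the weight \<open>u m\<close> is 0 and its inverse
      is \<open>top\<close>. Since \<open>F m\<close> vanishes almost everywhere for such
      \<open>m\<close>, the rule \<open>0 * top = 0\<close> keeps the factorisation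
      \<open>F m = u m * v m\<close> valid.\<close>
    then have ae: "AE s in M. \<forall>m. a m = 0 \<longrightarrow> F m s = 0"
      by (auto simp: AE_all_countable)
    have point: "(\<Sum>m. F m s) \<le> (\<Sum>m. a m) powr\<^sub>e (1 / p') * (\<Sum>m. v m s powr\<^sub>e p) powr\<^sub>e (1 / p)"
      if "\<forall>m. a m = 0 \<longrightarrow> F m s = 0" for s
    proof -
      have "u m * v m s = F m s" for m
      proof (cases "a m = 0")
        case False
        then have "u m * inverse (u m) = 1"
          using fin by (simp add: u_def ennreal_divide_self less_top flip: divide_ennreal_def)
        moreover have "u m * v m s = F m s * (u m * inverse (u m))"
          by (simp only: v_def mult_ac)
        ultimately show ?thesis by simp
      qed (use that in \<open>simp add: v_def u_def\<close>)
      moreover have "u m powr\<^sub>e p' = a m" for m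
        using p'(1) by (simp add: u_def ennreal_powr_powr)
      moreover have "(\<Sum>m. u m * v m s)
          \<le> (\<Sum>m. u m powr\<^sub>e p') powr\<^sub>e (1 / p') * (\<Sum>m. v m s powr\<^sub>e p) powr\<^sub>e (1 / p)"
        using nn_integral_holder[OF zero_less_one p'(1) _ p'(2), of u "count_space UNIV" "\<lambda>m. v m s"] p
        unfolding nn_integral_count_space_nat div_by_1 ennreal_powr_one by fastforce
      ultimately show ?thesis by (simp only:)
    qed
    have vint: "(\<integral>\<^sup>+s. v m s powr\<^sub>e p \<partial>M) \<le> a m" for m
    proof (cases "a m = 0")
      case True
      from ae have "AE s in M. v m s = 0"
      proof eventually_elim
        case (elim s)
        then have "F m s = 0" using True by blast
        then show ?case by (simp only: v_def mult_zero_left)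
      qed
      then have "(\<integral>\<^sup>+s. v m s powr\<^sub>e p \<partial>M) = 0"
        by (subst nn_integral_0_iff_AE) simp_all
      then show ?thesis by simp
    next
      case False
      \<comment> \<open>As \<open>1 / p' + 1 / p = 1\<close>, dividing \<open>a m\<close> by
        \<open>u m\<close> leaves \<open>a m\<close> to the power \<open>1 / p\<close>, whose
        \<open>p\<close>-th power is \<open>a m\<close> again.\<close>
      have "u m * a m powr\<^sub>e (1 / p) = a m"
        unfolding u_def ennreal_powr_add p'(2)[symmetric] by simp
      moreover have "u m * inverse (u m) = 1"
        using False fin by (simp add: u_def ennreal_divide_self less_top flip: divide_ennreal_def)
      moreover have "a m powr\<^sub>e (1 / p) * (u m * inverse (u m)) = u m * a m powr\<^sub>e (1 / p) * inverse (u m)"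
        by (simp only: mult_ac)
      ultimately have "a m * inverse (u m) = a m powr\<^sub>e (1 / p)"
        by simp
      moreover have "(\<integral>\<^sup>+s. v m s powr\<^sub>e p \<partial>M) = (a m * inverse (u m)) powr\<^sub>e p"
        using p by (simp add: v_def ennreal_powr_mult nn_integral_multc a)
      ultimately show ?thesis using p by (simp add: ennreal_powr_powr)
    qed
    \<comment> \<open>Raised to the power \<open>p\<close>, the first factor of \<open>point\<close>
      gets exponent \<open>p / p' = p - 1\<close>; after the exchange of sum and integral,
      \<open>vint\<close> supplies the missing power of the sum.\<close>
    have "(\<integral>\<^sup>+s. (\<Sum>m. F m s) powr\<^sub>e p \<partial>M)
        \<le> (\<integral>\<^sup>+s. (\<Sum>m. a m) powr\<^sub>e (p - 1) * (\<Sum>m. v m s powr\<^sub>e p) \<partial>M)"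
    proof (rule nn_integral_mono_AE, use ae in eventually_elim)
      case (elim s)
      have "1 / p' * p = p - 1" "1 / p * p = 1"
        using p p'(3) by simp_all
      with ennreal_powr_mono[OF _ point[OF elim], of p] p
      show ?case by (simp only: ennreal_powr_mult ennreal_powr_powr ennreal_powr_one)
    qed
    also have "\<dots> = (\<Sum>m. a m) powr\<^sub>e (p - 1) * (\<Sum>m. \<integral>\<^sup>+s. v m s powr\<^sub>e p \<partial>M)"
      by (simp add: nn_integral_cmult nn_integral_suminf)
    also have "\<dots> \<le> (\<Sum>m. a m) powr\<^sub>e (p - 1) * (\<Sum>m. a m)"
      by (intro mult_left_mono suminf_le vint) auto
    also have "\<dots> = (\<Sum>m. a m) powr\<^sub>e p"
      using ennreal_powr_add[of "\<Sum>m. a m" "p - 1" 1] by simp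
    finally show ?thesis
      using p by (simp add: ennreal_powr_le_imp_le[of p] ennreal_powr_powr)
  qed simp
  then show ?thesis by (simp add: a_def)
qed

section \<open>Iterated norms on Borel functions\<close>

text \<open>One step of \<open>iterated_norm\<close>, with \<open>lborel\<close> in place of
  \<open>lebesgue\<close>: completing a measure changes no nonnegative integral, and Borel sections
  are measurable for \<open>lborel\<close>.\<close>

definition coord_norm :: "real \<Rightarrow> 'n \<Rightarrow> (real ^ 'n \<Rightarrow> ennreal) \<Rightarrow> real ^ 'n \<Rightarrow> ennreal" where
  "coord_norm p i F x =
     (\<integral>\<^sup>+ s. F (\<chi> j. if j = i then s else x $ j) powr\<^sub>e p \<partial>lborel) powr\<^sub>e (1 / p)"

lemma iterated_norm_Cons [simp]:
  "iterated_norm p (i # is) F = iterated_norm p is (coord_norm (p $ i) i F)"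
  by (simp add: coord_norm_def[abs_def] nn_integral_completion)

declare iterated_norm.simps(2) [simp del]

lemma borel_measurable_coord_update:
  "(\<lambda>(x, s). \<chi> j. if j = i then s else x $ j) \<in>
     borel_measurable (borel \<Otimes>\<^sub>M borel :: ((real ^ 'n::finite) \<times> real) measure)"
  unfolding borel_prod case_prod_beta
proof (intro borel_measurable_continuous_onI continuous_on_vec_lambda)
  fix j
  show "continuous_on UNIV (\<lambda>z :: (real ^ 'n) \<times> real. if j = i then snd z else fst z $ j)"
    by (cases "j = i") (auto intro!: continuous_intros)
qed

text \<open>Joint measurability in the point and the slice variable makes the parameter integral
  measurable. Borel functions thus stay Borel under each step, which allows the one-variable
  inequalities to be iterated.\<close>

lemma borel_measurable_coord_norm [measurable (raw)]:
  fixes F :: "real ^ 'n::finite \<Rightarrow> ennreal"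
  assumes [measurable]: "F \<in> borel_measurable borel"
  shows "coord_norm p i F \<in> borel_measurable borel"
proof -
  note borel_measurable_coord_update[of i, measurable]
  have "(\<lambda>z. F ((\<lambda>(x, s). \<chi> j. if j = i then s else x $ j) z)) \<in> borel_measurable (borel \<Otimes>\<^sub>M borel)"
    by measurable
  then have "(\<lambda>(x, s). F (\<chi> j. if j = i then s else x $ j) powr\<^sub>e p)
      \<in> borel_measurable (borel \<Otimes>\<^sub>M lborel)"
    unfolding measurable_cong_sets[OF sets_pair_measure_cong[OF refl sets_lborel] refl]
    by (simp add: case_prod_beta borel_measurable_ennreal_powr)
  then have "(\<lambda>x. \<integral>\<^sup>+ s. F (\<chi> j. if j = i then s else x $ j) powr\<^sub>e p \<partial>lborel) \<in> borel_measurable borel"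
    by (intro lborel.borel_measurable_nn_integral)
  then show ?thesis
    unfolding coord_norm_def[abs_def] by measurable
qed

lemma borel_measurable_section:
  fixes F :: "real ^ 'n::finite \<Rightarrow> ennreal"
  assumes "F \<in> borel_measurable borel"
  shows "(\<lambda>s. F (\<chi> j. if j = i then s else x $ j)) \<in> borel_measurable borel"
proof -
  have "(\<lambda>s. \<chi> j. if j = i then s else x $ j) \<in> borel_measurable borel"
  proof (intro borel_measurable_continuous_onI continuous_on_vec_lambda)
    fix j
    show "continuous_on UNIV (\<lambda>s. if j = i then s else x $ j)"
      by (cases "j = i") (auto intro!: continuous_intros)
  qed
  from measurable_compose[OF this assms] show ?thesis .
qed

lemma coord_norm_mono: "(\<And>x. F x \<le> G x) \<Longrightarrow> 0 < p \<Longrightarrow> coord_norm p i F x \<le> coord_norm p i G x"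
  unfolding coord_norm_def by (intro ennreal_powr_mono nn_integral_mono) auto

lemma iterated_norm_mono:
  "(\<And>x. F x \<le> G x) \<Longrightarrow> (\<And>i. 0 < p $ i) \<Longrightarrow> iterated_norm p is F x \<le> iterated_norm p is G x"
proof (induction "is" arbitrary: F G x)
  case (Cons i "is")
  have "coord_norm (p $ i) i F x \<le> coord_norm (p $ i) i G x" for x
    using Cons.prems by (intro coord_norm_mono)
  with Cons show ?case by simp
qed simp

text \<open>The exponent relation holds in every coordinate, so the innermost norm of the product is
  bounded by a product of norms; monotonicity carries this outwards, and the induction hypothesis
  applies to the two coordinate norms.\<close>

lemma iterated_norm_holder:
  fixes F G :: "real ^ 'n::finite \<Rightarrow> ennreal"
  assumes "\<And>i. 0 < q $ i" "\<And>i. 0 < p1 $ i" "\<And>i. 0 < p2 $ i"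
    "\<And>i. 1 / q $ i = 1 / p1 $ i + 1 / p2 $ i"
    and "F \<in> borel_measurable borel" "G \<in> borel_measurable borel"
  shows "iterated_norm q is (\<lambda>x. F x * G x) x \<le> iterated_norm p1 is F x * iterated_norm p2 is G x"
  using assms(5,6)
proof (induction "is" arbitrary: F G x)
  case (Cons i "is")
  have "coord_norm (q $ i) i (\<lambda>x. F x * G x) x \<le> coord_norm (p1 $ i) i F x * coord_norm (p2 $ i) i G x" for x
    unfolding coord_norm_def using assms(1-4) Cons.prems
    by (intro nn_integral_holder) (auto intro: borel_measurable_section)
  then have "iterated_norm q (i # is) (\<lambda>x. F x * G x) x
      \<le> iterated_norm q is (\<lambda>x. coord_norm (p1 $ i) i F x * coord_norm (p2 $ i) i G x) x"
    unfolding iterated_norm_Cons using assms(1) by (rule iterated_norm_mono)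
  also have "\<dots> \<le> iterated_norm p1 (i # is) F x * iterated_norm p2 (i # is) G x"
    using Cons by (simp add: borel_measurable_coord_norm)
  finally show ?case .
qed simp

lemma iterated_norm_suminf:
  fixes F :: "nat \<Rightarrow> real ^ 'n::finite \<Rightarrow> ennreal"
  assumes "\<And>i. 1 < p $ i" and "\<And>m. F m \<in> borel_measurable borel"
  shows "iterated_norm p is (\<lambda>x. \<Sum>m. F m x) x \<le> (\<Sum>m. iterated_norm p is (F m) x)"
  using assms(2)
proof (induction "is" arbitrary: F x)
  case (Cons i "is")
  have "coord_norm (p $ i) i (\<lambda>x. \<Sum>m. F m x) x \<le> (\<Sum>m. coord_norm (p $ i) i (F m) x)" for x
    unfolding coord_norm_def using assms(1) Cons.prems
    by (intro nn_integral_minkowski) (auto intro: borel_measurable_section)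
  then have "iterated_norm p (i # is) (\<lambda>x. \<Sum>m. F m x) x
      \<le> iterated_norm p is (\<lambda>x. \<Sum>m. coord_norm (p $ i) i (F m) x) x"
    unfolding iterated_norm_Cons using assms(1) less_trans[OF zero_less_one]
    by (intro iterated_norm_mono) blast+
  also have "\<dots> \<le> (\<Sum>m. iterated_norm p (i # is) (F m) x)"
    using Cons by (simp add: borel_measurable_coord_norm)
  finally show ?case .
qed simp

text \<open>The factor \<open>c\<close> may be \<open>top\<close>; this case arises when a function
  is integrated along lines on which it is constant.\<close>

lemma iterated_norm_cmult:
  fixes F :: "real ^ 'n::finite \<Rightarrow> ennreal"
  assumes "\<And>i. 0 < p $ i" and "F \<in> borel_measurable borel"
  shows "iterated_norm p is (\<lambda>x. c * F x) x = c * iterated_norm p is F x"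
  using assms(2)
proof (induction "is" arbitrary: F x)
  case (Cons i "is")
  have "coord_norm (p $ i) i (\<lambda>x. c * F x) = (\<lambda>x. c * coord_norm (p $ i) i F x)"
    using assms(1)[of i] Cons.prems
    by (auto simp: fun_eq_iff coord_norm_def ennreal_powr_mult nn_integral_cmult ennreal_powr_powr
        borel_measurable_section borel_measurable_ennreal_powr)
  then show ?case
    using Cons by (simp add: borel_measurable_coord_norm)
qed simp

lemma coord_norm_cong_coords:
  assumes "\<And>x y. (\<forall>j\<in>A. x $ j = y $ j) \<Longrightarrow> F x = F y" "\<forall>j\<in>A - {i}. x $ j = y $ j"
  shows "coord_norm p i F x = coord_norm p i F y"
proof -
  have "F (\<chi> j. if j = i then s else x $ j) = F (\<chi> j. if j = i then s else y $ j)" for s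
    using assms(2) by (intro assms(1)) auto
  then show ?thesis by (simp add: coord_norm_def)
qed

text \<open>\<open>A\<close> is a set of coordinates that determines \<open>F\<close>, and each step
  deletes the integrated one. When the list exhausts all coordinates the result is constant, so the
  point of evaluation is immaterial.\<close>

lemma iterated_norm_cong_coords:
  fixes F :: "real ^ 'n::finite \<Rightarrow> ennreal"
  assumes "\<And>x y. (\<forall>j\<in>A. x $ j = y $ j) \<Longrightarrow> F x = F y" "\<forall>j\<in>A - set is. x $ j = y $ j"
  shows "iterated_norm p is F x = iterated_norm p is F y"
  using assms
proof (induction "is" arbitrary: F A)
  case (Cons i "is")
  have "iterated_norm p is (coord_norm (p $ i) i F) x = iterated_norm p is (coord_norm (p $ i) i F) y"
  proof (rule Cons.IH)
    show "coord_norm (p $ i) i F x = coord_norm (p $ i) i F y" if "\<forall>j\<in>A - {i}. x $ j = y $ j" for x y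
      using Cons.prems(1) that by (rule coord_norm_cong_coords)
    show "\<forall>j\<in>(A - {i}) - set is. x $ j = y $ j"
      using Cons.prems(2) by auto
  qed
  then show ?case by simp
qed simp

section \<open>Lebesgue measure as an iterated integral\<close>

lemma borel_measurable_vec_lambda:
  fixes f :: "'n::finite \<Rightarrow> 'a \<Rightarrow> real"
  assumes "\<And>j. f j \<in> borel_measurable M"
  shows "(\<lambda>x. \<chi> j. f j x) \<in> borel_measurable M"
  using assms by (subst borel_measurable_euclidean_space) (auto simp: Basis_vec_def inner_axis)

text \<open>Lebesgue measure is determined by its values on boxes, and the preimage of a box is a
  product of intervals. This gives access to Tonelli's theorem on finite products.\<close>

lemma lborel_eq_distr_PiM_vec:
  "(lborel :: (real ^ 'n::finite) measure) = distr (PiM UNIV (\<lambda>_::'n. lborel)) borel (\<lambda>f. \<chi> j. f j)"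
proof (rule lborel_eqI)
  interpret product_sigma_finite "\<lambda>_::'n. lborel :: real measure" ..
  fix l u :: "real ^ 'n"
  assume lu: "\<And>b. b \<in> Basis \<Longrightarrow> l \<bullet> b \<le> u \<bullet> b"
  have le: "l $ i \<le> u $ i" for i
    using lu[of "axis i 1"] by (simp add: inner_axis)
  have "emeasure (distr (PiM UNIV (\<lambda>_::'n. lborel)) borel (\<lambda>f. \<chi> j. f j)) (box l u)
      = emeasure (PiM UNIV (\<lambda>_::'n. lborel)) ((\<lambda>f. \<chi> j. f j) -` box l u \<inter> space (PiM UNIV (\<lambda>_::'n. lborel)))"
    by (intro emeasure_distr borel_measurable_vec_lambda) auto
  also have "(\<lambda>f. \<chi> j. f j) -` box l u \<inter> space (PiM UNIV (\<lambda>_::'n. lborel)) = (\<Pi>\<^sub>E i\<in>UNIV. {l $ i<..<u $ i})"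
    by (auto simp: mem_box_cart space_PiM PiE_iff)
  also have "emeasure (PiM UNIV (\<lambda>_::'n. lborel)) \<dots> = (\<Prod>i\<in>UNIV. ennreal (u $ i - l $ i))"
    using le by (subst emeasure_PiM) auto
  also have "\<dots> = ennreal (\<Prod>b\<in>Basis. (u - l) \<bullet> b)"
  proof -
    have Basis_eq: "(Basis :: (real ^ 'n) set) = (\<lambda>i. axis i 1) ` UNIV"
      by (auto simp: Basis_vec_def)
    have "inj (\<lambda>i::'n. axis i (1::real))"
      by (auto simp: inj_on_def axis_eq_axis)
    then have "(\<Prod>b\<in>Basis. (u - l) \<bullet> b) = (\<Prod>i\<in>UNIV. u $ i - l $ i)"
      unfolding Basis_eq by (simp add: prod.reindex inner_axis)
    then show ?thesis
      using le by (simp add: prod_ennreal)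
  qed
  finally show "emeasure (distr (PiM UNIV (\<lambda>_::'n. lborel)) borel (\<lambda>f. \<chi> j. f j)) (box l u)
    = ennreal (\<Prod>b\<in>Basis. (u - l) \<bullet> b)" .
qed simp

text \<open>With all exponents 1 the powers disappear and the recursion is Tonelli's theorem, one
  coordinate entering the product at a time; coordinates outside the list stay frozen at
  \<open>x\<close>.\<close>

lemma iterated_norm_1_eq_nn_integral_PiM:
  fixes F :: "real ^ 'n::finite \<Rightarrow> ennreal"
  assumes "distinct is" "F \<in> borel_measurable borel"
  shows "iterated_norm (\<chi> i. 1) is F x =
    (\<integral>\<^sup>+ y. F (\<chi> j. if j \<in> set is then y j else x $ j) \<partial>PiM (set is) (\<lambda>_. lborel))"
  using assms
proof (induction "is" arbitrary: F)
  case Nil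
  then show ?case by (simp add: PiM_empty nn_integral_count_space_finite)
next
  case (Cons i "is")
  interpret product_sigma_finite "\<lambda>_::'n. lborel :: real measure" ..
  have "iterated_norm (\<chi> i. 1) (i # is) F x = iterated_norm (\<chi> i. 1) is (coord_norm 1 i F) x"
    by simp
  also have "\<dots> = (\<integral>\<^sup>+ y. coord_norm 1 i F (\<chi> j. if j \<in> set is then y j else x $ j) \<partial>PiM (set is) (\<lambda>_. lborel))"
    using Cons by (intro Cons.IH borel_measurable_coord_norm) auto
  also have "\<dots> = (\<integral>\<^sup>+ y. \<integral>\<^sup>+ s. F (\<chi> j. if j \<in> set (i # is) then (y(i := s)) j else x $ j) \<partial>lborel \<partial>PiM (set is) (\<lambda>_. lborel))"
  proof -
    have "(\<chi> j. if j = i then s else (\<chi> j. if j \<in> set is then y j else x $ j) $ j)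
        = (\<chi> j. if j \<in> set (i # is) then (y(i := s)) j else x $ j)" for s and y :: "'n \<Rightarrow> real"
      by (auto simp: vec_eq_iff)
    then show ?thesis
      unfolding coord_norm_def ennreal_powr_one div_by_1 by presburger
  qed
  also have "\<dots> = (\<integral>\<^sup>+ y. F (\<chi> j. if j \<in> set (i # is) then y j else x $ j) \<partial>PiM (set (i # is)) (\<lambda>_. lborel))"
    unfolding list.set
  proof (subst product_nn_integral_insert)
    have "(\<lambda>y. \<chi> j. if j \<in> insert i (set is) then y j else x $ j)
        \<in> borel_measurable (PiM (insert i (set is)) (\<lambda>_. lborel))"
    proof (rule borel_measurable_vec_lambda)
      fix j
      show "(\<lambda>y. if j \<in> insert i (set is) then y j else x $ j)
          \<in> borel_measurable (PiM (insert i (set is)) (\<lambda>_. lborel))"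
        by (cases "j \<in> insert i (set is)") auto
    qed
    from measurable_compose[OF this Cons.prems(2)]
    show "(\<lambda>y. F (\<chi> j. if j \<in> insert i (set is) then y j else x $ j))
        \<in> borel_measurable (PiM (insert i (set is)) (\<lambda>_. lborel))" .
  qed (use Cons.prems in auto)
  finally show ?case .
qed

lemma iterated_norm_1_eq_nn_integral:
  fixes F :: "real ^ 'n::finite \<Rightarrow> ennreal"
  assumes "distinct is" "set is = UNIV" "F \<in> borel_measurable borel"
  shows "iterated_norm (\<chi> i. 1) is F x = (\<integral>\<^sup>+ y. F y \<partial>lborel)"
  using assms
  by (subst lborel_eq_distr_PiM_vec)
    (auto simp: iterated_norm_1_eq_nn_integral_PiM nn_integral_distr borel_measurable_vec_lambda)

section \<open>Null sets and almost everywhere inequalities\<close>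

lemma coord_update_coord_update:
  "(\<chi> j. if j = i then s else (\<chi> j. if j = i then t else x $ j) $ j) = (\<chi> j. if j = i then s else x $ j)"
  by (simp add: vec_eq_iff)

text \<open>Fubini for null sets. The outer quantifier runs over the full space, including the
  coordinate that the section overwrites, so that the result can be fed into the next coordinate
  step.\<close>

lemma AE_coord_update:
  fixes P :: "real ^ 'n::finite \<Rightarrow> bool"
  assumes "AE x in lborel. P x"
  shows "AE x in lborel. AE s in lborel. P (\<chi> j. if j = i then s else x $ j)"
proof -
  from assms obtain N where N: "{x. \<not> P x} \<subseteq> N" "emeasure lborel N = 0" "N \<in> sets lborel"
    by (auto elim!: AE_E)
  define F :: "real ^ 'n \<Rightarrow> ennreal" where "F = indicator N"
  have F [measurable]: "F \<in> borel_measurable borel"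
    using N(3) by (simp add: F_def)
  obtain js where js: "distinct js" "set js = UNIV - {i}"
    using finite_distinct_list[of "UNIV - {i}"] by auto
  then have is_: "distinct (i # js)" "set (i # js) = UNIV" by auto
  define h where "h = coord_norm 1 i F"
  have h [measurable]: "h \<in> borel_measurable borel"
    unfolding h_def by measurable
  have h0: "iterated_norm (\<chi> i. 1) js h 0 = 0"
    using iterated_norm_1_eq_nn_integral[OF is_ F, of 0] N(2,3) by (simp add: h_def F_def)
  \<comment> \<open>\<open>h\<close> is constant along coordinate \<open>i\<close>, so integrating
    it there multiplies by \<open>top\<close>. The other coordinates integrate \<open>h\<close> to
    the measure of \<open>N\<close>, which is 0, and \<open>top * 0 = 0\<close>.\<close>
  have "coord_norm 1 i h = (\<lambda>x. top * h x)"
    by (simp add: fun_eq_iff h_def coord_norm_def coord_update_coord_update mult.commute)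
  then have "(\<integral>\<^sup>+ x. h x \<partial>lborel) = 0"
    using iterated_norm_1_eq_nn_integral[OF is_ h, of 0] h0
    by (simp add: iterated_norm_cmult)
  then have "AE x in lborel. h x = 0"
    by (simp add: nn_integral_0_iff_AE)
  then show ?thesis
  proof eventually_elim
    case (elim x)
    then have "AE s in lborel. F (\<chi> j. if j = i then s else x $ j) = 0"
      by (simp add: h_def coord_norm_def nn_integral_0_iff_AE borel_measurable_section)
    then show ?case
      by eventually_elim (use N(1) in \<open>auto simp: F_def indicator_eq_0_iff\<close>)
  qed
qed

text \<open>On almost every line parallel to an axis the comparison holds almost everywhere, so each
  coordinate norm inherits it. The functions are arbitrary, so a Lebesgue measurable function can be
  compared with its Borel version.\<close>

lemma AE_iterated_norm_mono:
  fixes F :: "real ^ 'n::finite \<Rightarrow> ennreal"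
  assumes "AE x in lborel. F x \<le> G x" and "\<And>i. 0 < p $ i"
  shows "AE x in lborel. iterated_norm p is F x \<le> iterated_norm p is G x"
  using assms(1)
proof (induction "is" arbitrary: F G)
  case (Cons i "is")
  have "AE x in lborel. coord_norm (p $ i) i F x \<le> coord_norm (p $ i) i G x"
    using AE_coord_update[OF Cons.prems, of i]
  proof eventually_elim
    case (elim x)
    then show ?case
      unfolding coord_norm_def using assms(2)[of i]
      by (intro ennreal_powr_mono nn_integral_mono_AE) (auto intro: ennreal_powr_mono)
  qed
  from Cons.IH[OF this] show ?case by simp
qed simp

text \<open>Once all coordinates are integrated out both sides are constant, so one point of the
  almost everywhere set decides; it exists because the whole space is not a null set.\<close>

lemma iterated_norm_mono_AE:
  fixes F :: "real ^ 'n::finite \<Rightarrow> ennreal"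
  assumes "AE x in lborel. F x \<le> G x" "\<And>i. 0 < p $ i" "set is = UNIV"
  shows "iterated_norm p is F x \<le> iterated_norm p is G x"
proof -
  have "ae_filter (lborel :: (real ^ 'n) measure) \<noteq> bot"
    using AE_iff_measurable[of UNIV "lborel :: (real ^ 'n) measure" "\<lambda>_. False"]
    by (simp add: trivial_limit_def)
  then obtain y where "iterated_norm p is F y \<le> iterated_norm p is G y"
    using eventually_happens'[OF _ AE_iterated_norm_mono[OF assms(1,2)]] by blast
  moreover have "iterated_norm p is H y = iterated_norm p is H x" for H
    using assms(3) by (intro iterated_norm_cong_coords[of UNIV]) (simp_all flip: vec_eq_iff)
  ultimately show ?thesis by metis
qed

section \<open>The mixed norm of Lebesgue measurable functions\<close>

definition mixed_nn_norm :: "real ^ 'n::{finite,linorder} \<Rightarrow> (real ^ 'n::{finite,linorder} \<Rightarrow> ennreal) \<Rightarrow> ennreal" where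
  "mixed_nn_norm p F = iterated_norm p (sorted_list_of_set UNIV) F 0"

lemma mixed_norm_eq: "mixed_norm p f = mixed_nn_norm p (\<lambda>x. ennreal (norm (f x)))"
  by (simp add: mixed_norm_def mixed_nn_norm_def)

lemma mixed_nn_norm_mono_AE:
  assumes "AE x in lebesgue. F x \<le> G x" "\<And>i. 0 < p $ i"
  shows "mixed_nn_norm p F \<le> mixed_nn_norm p G"
  using assms unfolding mixed_nn_norm_def AE_completion_iff by (intro iterated_norm_mono_AE) simp_all

lemma mixed_nn_norm_mono:
  "(\<And>x. F x \<le> G x) \<Longrightarrow> (\<And>i. 0 < p $ i) \<Longrightarrow> mixed_nn_norm p F \<le> mixed_nn_norm p G"
  by (rule mixed_nn_norm_mono_AE) simp_all

lemma mixed_nn_norm_cong_AE: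
  assumes "AE x in lebesgue. F x = G x" "\<And>i. 0 < p $ i"
  shows "mixed_nn_norm p F = mixed_nn_norm p G"
proof (intro antisym mixed_nn_norm_mono_AE assms(2))
  show "AE x in lebesgue. F x \<le> G x" "AE x in lebesgue. G x \<le> F x"
    using assms(1) by (eventually_elim, simp)+
qed

lemma lebesgue_AE_eq_borel:
  fixes F :: "'a::euclidean_space \<Rightarrow> ennreal"
  assumes "F \<in> borel_measurable lebesgue"
  obtains G where "G \<in> borel_measurable borel" "AE x in lebesgue. F x = G x"
  using completion_ex_borel_measurable[OF assms] by (auto simp: AE_completion_iff)

lemma mixed_nn_norm_holder:
  assumes "\<And>i. 0 < q $ i" "\<And>i. 0 < p1 $ i" "\<And>i. 0 < p2 $ i"
    "\<And>i. 1 / q $ i = 1 / p1 $ i + 1 / p2 $ i"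
    and "F \<in> borel_measurable lebesgue" "G \<in> borel_measurable lebesgue"
  shows "mixed_nn_norm q (\<lambda>x. F x * G x) \<le> mixed_nn_norm p1 F * mixed_nn_norm p2 G"
proof -
  obtain F' where F': "F' \<in> borel_measurable borel" "AE x in lebesgue. F x = F' x"
    using assms(5) by (rule lebesgue_AE_eq_borel)
  obtain G' where G': "G' \<in> borel_measurable borel" "AE x in lebesgue. G x = G' x"
    using assms(6) by (rule lebesgue_AE_eq_borel)
  have "AE x in lebesgue. F x * G x = F' x * G' x"
    using F'(2) G'(2) by eventually_elim simp
  then have "mixed_nn_norm q (\<lambda>x. F x * G x) = mixed_nn_norm q (\<lambda>x. F' x * G' x)"
    using assms(1) by (rule mixed_nn_norm_cong_AE)
  also have "\<dots> \<le> mixed_nn_norm p1 F' * mixed_nn_norm p2 G'"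
    unfolding mixed_nn_norm_def using assms(1-4) F'(1) G'(1) by (rule iterated_norm_holder)
  also have "mixed_nn_norm p1 F' = mixed_nn_norm p1 F"
    using mixed_nn_norm_cong_AE[OF F'(2) assms(2)] by simp
  also have "mixed_nn_norm p2 G' = mixed_nn_norm p2 G"
    using mixed_nn_norm_cong_AE[OF G'(2) assms(3)] by simp
  finally show ?thesis .
qed

lemma mixed_nn_norm_suminf:
  assumes "\<And>i. 1 < p $ i" and "\<And>m. F m \<in> borel_measurable lebesgue"
  shows "mixed_nn_norm p (\<lambda>x. \<Sum>m. F m x) \<le> (\<Sum>m. mixed_nn_norm p (F m))"
proof -
  have p: "0 < p $ i" for i
    using assms(1)[of i] by linarith
  have "\<exists>G. G \<in> borel_measurable borel \<and> (AE x in lebesgue. F m x = G x)" for m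
    using lebesgue_AE_eq_borel[OF assms(2)] by metis
  then obtain G where G: "\<And>m. G m \<in> borel_measurable borel" "\<And>m. AE x in lebesgue. F m x = G m x"
    by metis
  have "AE x in lebesgue. \<forall>m. F m x = G m x"
    using G(2) by (simp add: AE_all_countable)
  then have "AE x in lebesgue. (\<Sum>m. F m x) = (\<Sum>m. G m x)"
    by eventually_elim simp
  then have "mixed_nn_norm p (\<lambda>x. \<Sum>m. F m x) = mixed_nn_norm p (\<lambda>x. \<Sum>m. G m x)"
    using p by (rule mixed_nn_norm_cong_AE)
  also have "\<dots> \<le> (\<Sum>m. mixed_nn_norm p (G m))"
    unfolding mixed_nn_norm_def using assms(1) G(1) by (rule iterated_norm_suminf)
  also have "\<dots> = (\<Sum>m. mixed_nn_norm p (F m))"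
    using mixed_nn_norm_cong_AE[OF G(2) p] by simp
  finally show ?thesis .
qed

lemma mixed_nn_norm_cmult:
  assumes "\<And>i. 0 < p $ i" and "F \<in> borel_measurable lebesgue"
  shows "mixed_nn_norm p (\<lambda>x. c * F x) = c * mixed_nn_norm p F"
proof -
  obtain F' where F': "F' \<in> borel_measurable borel" "AE x in lebesgue. F x = F' x"
    using assms(2) by (rule lebesgue_AE_eq_borel)
  have "AE x in lebesgue. c * F x = c * F' x"
    using F'(2) by eventually_elim simp
  then have "mixed_nn_norm p (\<lambda>x. c * F x) = mixed_nn_norm p (\<lambda>x. c * F' x)"
    using assms(1) by (rule mixed_nn_norm_cong_AE)
  also have "\<dots> = c * mixed_nn_norm p F'"
    unfolding mixed_nn_norm_def using assms(1) F'(1) by (rule iterated_norm_cmult)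
  also have "mixed_nn_norm p F' = mixed_nn_norm p F"
    using mixed_nn_norm_cong_AE[OF F'(2) assms(1)] by simp
  finally show ?thesis .
qed

text \<open>This turns the mixed Hoelder inequality with target exponents 1 into a bound for
  ordinary integrals.\<close>

lemma mixed_nn_norm_1:
  fixes F :: "real ^ 'n::{finite,linorder} \<Rightarrow> ennreal"
  assumes "F \<in> borel_measurable lebesgue"
  shows "mixed_nn_norm (\<chi> i. 1) F = (\<integral>\<^sup>+ x. F x \<partial>lebesgue)"
proof -
  obtain F' where F': "F' \<in> borel_measurable borel" "AE x in lebesgue. F x = F' x"
    using assms by (rule lebesgue_AE_eq_borel)
  have "mixed_nn_norm (\<chi> i. 1) F = mixed_nn_norm (\<chi> i. 1) F'"
    using F'(2) by (rule mixed_nn_norm_cong_AE) simp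
  also have "\<dots> = (\<integral>\<^sup>+ x. F' x \<partial>lborel)"
    unfolding mixed_nn_norm_def using F'(1) by (intro iterated_norm_1_eq_nn_integral) simp_all
  also have "\<dots> = (\<integral>\<^sup>+ x. F x \<partial>lebesgue)"
    using nn_integral_cong_AE[OF F'(2)] by (simp add: nn_integral_completion)
  finally show ?thesis .
qed

section \<open>Mixed norms of cubes and balls\<close>

lemma coord_norm_prod_indicator:
  fixes c :: ennreal and i :: "'n::finite"
  assumes "0 < p" "0 \<le> a" "i \<in> A"
  shows "coord_norm p i (\<lambda>x. c * (\<Prod>j\<in>A. indicator {-a..a} (x $ j))) =
    (\<lambda>x. (c * ennreal ((2 * a) powr (1 / p))) * (\<Prod>j\<in>A - {i}. indicator {-a..a} (x $ j)))"
proof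
  fix x :: "real ^ 'n"
  define d :: ennreal where "d = c * (\<Prod>j\<in>A - {i}. indicator {-a..a} (x $ j))"
  have "c * (\<Prod>j\<in>A. indicator {-a..a} ((\<chi> j. if j = i then s else x $ j) $ j))
      = d * indicator {-a..a} s" for s
    using prod.remove[OF finite assms(3), of "\<lambda>j. indicator {-a..a} ((\<chi> j. if j = i then s else x $ j) $ j) :: ennreal"]
    by (simp add: d_def mult_ac)
  moreover have "(d * indicator {-a..a} s) powr\<^sub>e p = d powr\<^sub>e p * indicator {-a..a} s" for s
    by (cases "s \<in> {-a..a}") simp_all
  ultimately have "coord_norm p i (\<lambda>x. c * (\<Prod>j\<in>A. indicator {-a..a} (x $ j))) x
      = (d powr\<^sub>e p * ennreal (2 * a)) powr\<^sub>e (1 / p)"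
    using assms(2) unfolding coord_norm_def by (simp add: nn_integral_cmult_indicator)
  also have "\<dots> = d * ennreal ((2 * a) powr (1 / p))"
    using assms(1,2) by (simp add: ennreal_powr_mult ennreal_powr_powr)
  finally show "coord_norm p i (\<lambda>x. c * (\<Prod>j\<in>A. indicator {-a..a} (x $ j))) x =
    c * ennreal ((2 * a) powr (1 / p)) * (\<Prod>j\<in>A - {i}. indicator {-a..a} (x $ j))"
    by (simp add: d_def mult_ac)
qed

text \<open>The indicator of a cube factorises over the coordinates, and each step trades one factor
  for a power of the side length \<open>2 * a\<close>. The induction accumulates these powers in
  \<open>c\<close> and shrinks \<open>A\<close>.\<close>

lemma iterated_norm_prod_indicator:
  fixes p :: "real ^ 'n::finite"
  assumes "\<And>i. 0 < p $ i" "0 \<le> a" "distinct is" "set is \<subseteq> A"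
  shows "iterated_norm p is (\<lambda>x. c * (\<Prod>j\<in>A. indicator {-a..a} (x $ j))) x =
    c * (\<Prod>i\<in>set is. ennreal ((2 * a) powr (1 / p $ i))) * (\<Prod>j\<in>A - set is. indicator {-a..a} (x $ j))"
  using assms(3,4)
proof (induction "is" arbitrary: A c)
  case (Cons i "is")
  have "A - {i} - set is = A - set (i # is)" by auto
  moreover have "iterated_norm p is (\<lambda>x. (c * ennreal ((2 * a) powr (1 / p $ i))) * (\<Prod>j\<in>A - {i}. indicator {-a..a} (x $ j))) x
      = (c * ennreal ((2 * a) powr (1 / p $ i))) * (\<Prod>i\<in>set is. ennreal ((2 * a) powr (1 / p $ i)))
          * (\<Prod>j\<in>A - {i} - set is. indicator {-a..a} (x $ j))"
    using Cons.prems by (intro Cons.IH) auto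
  moreover have "i \<in> A" "i \<notin> set is"
    using Cons.prems by auto
  ultimately show ?case
    using assms(1,2) by (simp only: iterated_norm_Cons coord_norm_prod_indicator) (simp add: mult.assoc)
qed simp

lemma mixed_nn_norm_cube:
  fixes p :: "real ^ 'n::{finite,linorder}"
  assumes "\<And>i. 0 < p $ i" "0 < a"
  shows "mixed_nn_norm p (\<lambda>x. \<Prod>j\<in>UNIV. indicator {-a..a} (x $ j)) = ennreal ((2 * a) powr (\<Sum>i\<in>UNIV. 1 / p $ i))"
proof -
  have "mixed_nn_norm p (\<lambda>x. 1 * (\<Prod>j\<in>UNIV. indicator {-a..a} (x $ j)))
      = (\<Prod>i\<in>UNIV. ennreal ((2 * a) powr (1 / p $ i)))"
    unfolding mixed_nn_norm_def using assms by (subst iterated_norm_prod_indicator) auto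
  also have "\<dots> = ennreal ((2 * a) powr (\<Sum>i\<in>UNIV. 1 / p $ i))"
    using assms by (simp add: prod_ennreal powr_sum)
  finally show ?thesis by simp
qed

lemma prod_indicator_vec:
  "(\<Prod>j\<in>UNIV. indicator S (x $ j)) = (indicator {x. \<forall>j. x $ j \<in> S} x :: ennreal)"
  for x :: "real ^ 'n::finite"
  by (auto simp: indicator_def)

lemma mixed_nn_norm_ball_le:
  fixes p :: "real ^ 'n::{finite,linorder}"
  assumes "\<And>i. 0 < p $ i" "0 < r"
  shows "mixed_nn_norm p (indicator (ball 0 r)) \<le> ennreal (2 powr (\<Sum>i\<in>UNIV. 1 / p $ i) * r powr (\<Sum>i\<in>UNIV. 1 / p $ i))"
proof -
  have "mixed_nn_norm p (indicator (ball 0 r)) \<le> mixed_nn_norm p (\<lambda>x. \<Prod>j\<in>UNIV. indicator {-r..r} (x $ j))"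
    unfolding prod_indicator_vec
  proof (rule mixed_nn_norm_mono[OF _ assms(1)])
    fix x :: "real ^ 'n::{finite,linorder}"
    have "\<bar>x $ j\<bar> \<le> r" if "norm x < r" for j
      using component_le_norm_cart[of x j] that by linarith
    then show "indicator (ball 0 r) x \<le> (indicator {x. \<forall>j. x $ j \<in> {-r..r}} x :: ennreal)"
      by (auto simp: indicator_def abs_le_iff) (smt (verit) abs_le_iff)+
  qed
  then show ?thesis
    using assms by (simp add: mixed_nn_norm_cube powr_mult)
qed

lemma mixed_nn_norm_ball_ge:
  fixes p :: "real ^ 'n::{finite,linorder}"
  assumes "\<And>i. 0 < p $ i" "0 < r"
  shows "ennreal ((1 / real CARD('n)) powr (\<Sum>i\<in>UNIV. 1 / p $ i) * r powr (\<Sum>i\<in>UNIV. 1 / p $ i))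
    \<le> mixed_nn_norm p (indicator (ball 0 r))"
proof -
  \<comment> \<open>Half the side of an inscribed cube: bounding the norm by the sum of the
    coordinates gives at most \<open>CARD('n) * a = r / 2\<close>, and the side is
    \<open>r / CARD('n)\<close>.\<close>
  define a where "a = r / (2 * real CARD('n))"
  have a: "0 < a" "2 * a = 1 / real CARD('n) * r" "real CARD('n) * a < r"
    using assms(2) by (auto simp: a_def)
  have "mixed_nn_norm p (\<lambda>x. \<Prod>j\<in>UNIV. indicator {-a..a} (x $ j)) \<le> mixed_nn_norm p (indicator (ball 0 r))"
    unfolding prod_indicator_vec
  proof (rule mixed_nn_norm_mono[OF _ assms(1)])
    fix x :: "real ^ 'n::{finite,linorder}"
    have "norm x < r" if "\<forall>j. x $ j \<in> {-a..a}"
    proof -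
      have "norm x \<le> (\<Sum>j\<in>UNIV. \<bar>x $ j\<bar>)"
        by (rule norm_le_l1_cart)
      also have "\<dots> \<le> of_nat (card (UNIV :: 'n set)) * a"
        using that by (intro sum_bounded_above) (auto simp: abs_le_iff minus_le_iff)
      finally show ?thesis using a(3) by simp
    qed
    then show "indicator {x. \<forall>j. x $ j \<in> {-a..a}} x \<le> (indicator (ball 0 r) x :: ennreal)"
      by (auto simp: indicator_def)
  qed
  then show ?thesis
    using assms a by (simp only: mixed_nn_norm_cube powr_mult)
qed

section \<open>The dual Hardy operator\<close>

lemma ennreal_mult_left: "0 \<le> a \<Longrightarrow> ennreal a * (ennreal b * K) = ennreal (a * b) * K"
  by (simp add: ennreal_mult' mult.assoc)

lemma borel_imp_lebesgue_measurable:
  "f \<in> borel_measurable borel \<Longrightarrow> f \<in> borel_measurable lebesgue"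
  by (simp add: measurable_completion)

lemma borel_measurable_indicator_ball [measurable]:
  "indicator (ball 0 r) \<in> borel_measurable (lebesgue :: (real ^ 'n::finite) measure)"
  by (rule borel_imp_lebesgue_measurable, rule borel_measurable_indicator) simp

lemma lebesgue_AE_eq_borel_complex:
  fixes f :: "'a::euclidean_space \<Rightarrow> complex"
  assumes [measurable]: "f \<in> borel_measurable lebesgue"
  obtains g where "g \<in> borel_measurable borel" "AE x in lebesgue. f x = g x"
proof -
  have "(\<lambda>x. Re (f x)) \<in> borel_measurable lebesgue" "(\<lambda>x. Im (f x)) \<in> borel_measurable lebesgue"
    by measurable
  from this[THEN completion_ex_borel_measurable_real]
  obtain u v where [measurable]: "u \<in> borel_measurable borel" "v \<in> borel_measurable borel"
    and ae: "AE x in lebesgue. Re (f x) = u x" "AE x in lebesgue. Im (f x) = v x"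
    by (auto simp: AE_completion_iff)
  have "(\<lambda>x. Complex (u x) (v x)) \<in> borel_measurable borel"
    unfolding Complex_eq by measurable
  moreover have "AE x in lebesgue. f x = Complex (u x) (v x)"
    using ae by eventually_elim (simp add: complex_eq_iff)
  ultimately show ?thesis by (rule that)
qed

text \<open>Replacing \<open>f\<close> by a Borel version changes no value of the operator and makes
  the integrand jointly Borel in \<open>x\<close> and \<open>t\<close>. Measurability of the
  parameter integral also covers points where the integral diverges and takes its default
  value.\<close>

lemma borel_measurable_dual_hardy:
  fixes f :: "real ^ 'n::finite \<Rightarrow> complex"
  assumes [measurable]: "f \<in> borel_measurable lebesgue"
  shows "dual_hardy f \<in> borel_measurable borel"
proof -
  obtain g where [measurable]: "g \<in> borel_measurable borel" and ae: "AE x in lebesgue. f x = g x"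
    using assms by (rule lebesgue_AE_eq_borel_complex)
  have [measurable]: "g \<in> borel_measurable lebesgue"
    by (rule borel_imp_lebesgue_measurable) measurable
  have [measurable]: "(\<lambda>t::real^'n. of_real (norm t ^ CARD('n)) :: complex) \<in> borel_measurable lebesgue"
    by (rule borel_imp_lebesgue_measurable) measurable
  have "dual_hardy f x = (\<integral>t. indicator {t. norm x \<le> norm t} t *\<^sub>R (g t / of_real (norm t ^ CARD('n))) \<partial>lborel)" for x
  proof -
    have [measurable]: "indicator {t::real^'n. norm x \<le> norm t} \<in> borel_measurable lebesgue"
      by (rule borel_imp_lebesgue_measurable) measurable
    have "dual_hardy f x = (\<integral>t. indicator {t. norm x \<le> norm t} t *\<^sub>R (g t / of_real (norm t ^ CARD('n))) \<partial>lebesgue)"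
      unfolding dual_hardy_def set_lebesgue_integral_def
    proof (rule integral_cong_AE)
      show "AE t in lebesgue. indicator {t. norm x \<le> norm t} t *\<^sub>R (f t / complex_of_real (norm t ^ CARD('n)))
          = indicator {t. norm x \<le> norm t} t *\<^sub>R (g t / complex_of_real (norm t ^ CARD('n)))"
        using ae by eventually_elim simp
    qed measurable
    also have "\<dots> = (\<integral>t. indicator {t. norm x \<le> norm t} t *\<^sub>R (g t / of_real (norm t ^ CARD('n))) \<partial>lborel)"
      by (rule integral_completion) measurable
    finally show ?thesis .
  qed
  moreover have "(\<lambda>x. \<integral>t. indicator {t. norm x \<le> norm t} t *\<^sub>R (g t / of_real (norm t ^ CARD('n))) \<partial>lborel) \<in> borel_measurable borel"
    by measurable
  ultimately show ?thesis by (simp cong: measurable_cong)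
qed

section \<open>Dyadic splitting of the kernel\<close>

lemma powr_dyadic:
  fixes r e :: real
  assumes "0 < r"
  shows "(r * 2 ^ j) powr e = r powr e * (2 powr e) ^ j"
    and "(r / 2 ^ j) powr e = r powr e * (2 powr - e) ^ j"
  using assms
  by (simp_all add: powr_mult powr_divide powr_powr powr_minus field_simps flip: powr_realpow)

text \<open>The cutoff is a number \<open>s\<close> instead of the norm of \<open>x\<close>, so one
  integral controls the operator at all points of a shell.\<close>

definition dual_hardy_kernel :: "real \<Rightarrow> real ^ 'n::finite \<Rightarrow> ennreal" where
  "dual_hardy_kernel s t = ennreal (1 / norm t ^ CARD('n)) * indicator {t. s \<le> norm t} t"

lemma borel_measurable_dual_hardy_kernel [measurable]:
  "dual_hardy_kernel s \<in> borel_measurable (lebesgue :: (real ^ 'n::finite) measure)"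
  unfolding dual_hardy_kernel_def[abs_def] by (rule borel_imp_lebesgue_measurable) measurable

text \<open>On the shell from \<open>s * 2 ^ j\<close> to twice that radius the kernel is at most
  its value at the inner radius. The shells are enlarged to balls because the central norms only see
  balls.\<close>

lemma dual_hardy_kernel_le:
  fixes t :: "real ^ 'n::finite"
  assumes "0 < s"
  shows "dual_hardy_kernel s t \<le> (\<Sum>j. ennreal (1 / (s * 2 ^ j) ^ CARD('n)) * indicator (ball 0 (2 * s * 2 ^ j)) t)"
proof (cases "s \<le> norm t")
  case True
  obtain k where "norm t / (2 * s) < 2 ^ k"
    using real_arch_pow[of 2 "norm t / (2 * s)"] by auto
  then have k: "norm t < 2 * s * 2 ^ k"
    using assms by (simp add: field_simps)
  \<comment> \<open>The index of the shell containing \<open>t\<close>: minimality gives the inner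
    radius for positive \<open>j\<close>, and the cutoff \<open>s \<le> norm t\<close> gives it for
    \<open>j = 0\<close>.\<close>
  define j where "j = (LEAST j. norm t < 2 * s * 2 ^ j)"
  have j: "norm t < 2 * s * 2 ^ j"
    unfolding j_def using k by (rule LeastI)
  have "s * 2 ^ j \<le> norm t"
  proof (cases j)
    case (Suc i)
    then have "\<not> norm t < 2 * s * 2 ^ i"
      unfolding j_def by (intro not_less_Least) simp
    then show ?thesis using Suc by simp
  qed (use True in simp)
  moreover have "0 < norm t"
    using assms True by linarith
  ultimately have "1 / norm t ^ CARD('n) \<le> 1 / (s * 2 ^ j) ^ CARD('n)"
    using assms by (intro divide_left_mono power_mono mult_pos_pos zero_less_power) auto
  then have "dual_hardy_kernel s t \<le> (\<Sum>j\<in>{j}. ennreal (1 / (s * 2 ^ j) ^ CARD('n)) * indicator (ball 0 (2 * s * 2 ^ j)) t)"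
    using True j by (simp add: dual_hardy_kernel_def ennreal_leI)
  also have "\<dots> \<le> (\<Sum>j. ennreal (1 / (s * 2 ^ j) ^ CARD('n)) * indicator (ball 0 (2 * s * 2 ^ j)) t)"
    by (rule sum_le_suminf) auto
  finally show ?thesis .
qed (simp add: dual_hardy_kernel_def)

text \<open>Dividing the bound on the \<open>j\<close>-th ball by the \<open>n\<close>-th power of
  the inner radius \<open>r * 2 ^ j / 2\<close> leaves \<open>2 ^ n * r powr e\<close> times
  \<open>(j + 1) * x ^ j\<close> with \<open>x = 2 powr e < 1\<close>. These terms sum to
  \<open>1 / (1 - x)^2\<close>. The linear factor makes room for the drift of averages.\<close>

lemma nn_integral_dual_hardy_kernel_le:
  fixes g :: "real ^ 'n::finite \<Rightarrow> ennreal"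
  assumes [measurable]: "g \<in> borel_measurable lebesgue"
    and "0 < r" "e < 0" "0 \<le> A"
    and bound: "\<And>j. (\<integral>\<^sup>+ t. g t * indicator (ball 0 (r * 2 ^ j)) t \<partial>lebesgue)
      \<le> ennreal (A * real (Suc j) * (r * 2 ^ j) powr (real CARD('n) + e)) * K"
  shows "(\<integral>\<^sup>+ t. g t * dual_hardy_kernel (r / 2) t \<partial>lebesgue)
    \<le> ennreal (A * 2 ^ CARD('n) / (1 - 2 powr e)\<^sup>2 * r powr e) * K"
proof -
  let ?n = "CARD('n)"
  have "(\<integral>\<^sup>+ t. g t * dual_hardy_kernel (r / 2) t \<partial>lebesgue)
      \<le> (\<integral>\<^sup>+ t. (\<Sum>j. ennreal (1 / (r / 2 * 2 ^ j) ^ ?n) * (g t * indicator (ball 0 (r * 2 ^ j)) t)) \<partial>lebesgue)"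
  proof (rule nn_integral_mono)
    fix t :: "real ^ 'n"
    have "g t * dual_hardy_kernel (r / 2) t
        \<le> g t * (\<Sum>j. ennreal (1 / (r / 2 * 2 ^ j) ^ ?n) * indicator (ball 0 (2 * (r / 2) * 2 ^ j)) t)"
      using assms(2) by (intro mult_left_mono dual_hardy_kernel_le) auto
    then show "g t * dual_hardy_kernel (r / 2) t
        \<le> (\<Sum>j. ennreal (1 / (r / 2 * 2 ^ j) ^ ?n) * (g t * indicator (ball 0 (r * 2 ^ j)) t))"
      by (simp add: mult.left_commute flip: ennreal_suminf_cmult)
  qed
  also have "\<dots> = (\<Sum>j. ennreal (1 / (r / 2 * 2 ^ j) ^ ?n) * (\<integral>\<^sup>+ t. g t * indicator (ball 0 (r * 2 ^ j)) t \<partial>lebesgue))"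
    by (simp add: nn_integral_suminf nn_integral_cmult)
  also have "\<dots> \<le> (\<Sum>j. ennreal (A * 2 ^ ?n * r powr e * (real (Suc j) * (2 powr e) ^ j)) * K)"
  proof (intro suminf_le summableI)
    fix j
    have "ennreal (1 / (r / 2 * 2 ^ j) ^ ?n) * (\<integral>\<^sup>+ t. g t * indicator (ball 0 (r * 2 ^ j)) t \<partial>lebesgue)
        \<le> ennreal (1 / (r / 2 * 2 ^ j) ^ ?n) * (ennreal (A * real (Suc j) * (r * 2 ^ j) powr (real ?n + e)) * K)"
      by (intro mult_left_mono bound) simp
    also have "\<dots> = ennreal (1 / (r / 2 * 2 ^ j) ^ ?n * (A * real (Suc j) * (r * 2 ^ j) powr (real ?n + e))) * K"
      using assms(2) by (intro ennreal_mult_left) simp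
    also have "1 / (r / 2 * 2 ^ j) ^ ?n * (A * real (Suc j) * (r * 2 ^ j) powr (real ?n + e))
        = A * 2 ^ ?n * r powr e * (real (Suc j) * (2 powr e) ^ j)"
    proof -
      have "(r * 2 ^ j) powr (real ?n + e) = (r * 2 ^ j) ^ ?n * (r powr e * (2 powr e) ^ j)"
        using assms(2) by (simp only: powr_add powr_dyadic(1)[symmetric]) (simp add: powr_realpow)
      moreover have "(r / 2 * 2 ^ j) ^ ?n = (r * 2 ^ j) ^ ?n / 2 ^ ?n"
        by (simp add: power_divide)
      moreover have "(r * 2 ^ j) ^ ?n \<noteq> 0"
        using assms(2) by simp
      ultimately show ?thesis by (simp only: field_simps) simp
    qed
    finally show "ennreal (1 / (r / 2 * 2 ^ j) ^ ?n) * (\<integral>\<^sup>+ t. g t * indicator (ball 0 (r * 2 ^ j)) t \<partial>lebesgue)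
      \<le> ennreal (A * 2 ^ ?n * r powr e * (real (Suc j) * (2 powr e) ^ j)) * K" .
  qed
  also have "\<dots> = ennreal (A * 2 ^ ?n * r powr e * (1 / (1 - 2 powr e)\<^sup>2)) * K"
  proof -
    have "2 powr e < 1"
      using assms(3) by (simp add: powr_less_one)
    then have "(\<lambda>j. real (Suc j) * (2 powr e) ^ j) sums (1 / (1 - 2 powr e)\<^sup>2)"
      using geometric_deriv_sums[of "2 powr e"] by simp
    from sums_mult[OF this, of "A * 2 ^ ?n * r powr e"] show ?thesis
      using assms(4) by (simp only: ennreal_suminf_multc) (subst suminf_ennreal_eq, auto)
  qed
  finally show ?thesis by (simp add: mult_ac)
qed

section \<open>Central quotients\<close>

lemma mixed_nn_norm_add:
  assumes "\<And>i. 1 < p $ i" and "F \<in> borel_measurable lebesgue" "G \<in> borel_measurable lebesgue"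
  shows "mixed_nn_norm p (\<lambda>x. F x + G x) \<le> mixed_nn_norm p F + mixed_nn_norm p G"
proof -
  have p: "0 < p $ i" for i
    using assms(1)[of i] by linarith
  \<comment> \<open>Padding by zeros turns the countable Minkowski inequality into the binary
    one.\<close>
  define H where "H m = (if m = 0 then F else if m = 1 then G else (\<lambda>_. 0))" for m :: nat
  have "mixed_nn_norm p (\<lambda>_. 0) = 0"
    using mixed_nn_norm_cmult[OF p, where c = 0 and F = "\<lambda>_. 0"] by simp
  then have "(\<Sum>m. mixed_nn_norm p (H m)) = mixed_nn_norm p F + mixed_nn_norm p G"
    by (subst suminf_finite[of "{0, 1}"]) (auto simp: H_def)
  moreover have "(\<Sum>m. H m x) = F x + G x" for x
    by (subst suminf_finite[of "{0, 1}"]) (auto simp: H_def)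
  moreover have "H m \<in> borel_measurable lebesgue" for m
    using assms(2,3) by (auto simp: H_def)
  ultimately show ?thesis
    using mixed_nn_norm_suminf[OF assms(1), of H] by simp
qed

text \<open>The kernel with a smaller cutoff dominates the integrand, so finiteness at one
  \<open>s\<close> yields convergence and a common bound at all points beyond it.\<close>

lemma dual_hardy_norm_le:
  fixes f :: "real ^ 'n::finite \<Rightarrow> complex"
  assumes [measurable]: "f \<in> borel_measurable lebesgue"
    and fin: "(\<integral>\<^sup>+ t. ennreal (norm (f t)) * dual_hardy_kernel s t \<partial>lebesgue) < \<infinity>" and s: "s \<le> norm x"
  shows "dual_hardy_defined_at f x"
    and "ennreal (norm (dual_hardy f x)) \<le> (\<integral>\<^sup>+ t. ennreal (norm (f t)) * dual_hardy_kernel s t \<partial>lebesgue)"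
proof -
  let ?g = "\<lambda>t. indicator {t. norm x \<le> norm t} t *\<^sub>R (f t / complex_of_real (norm t ^ CARD('n)))"
  have [measurable]: "(\<lambda>t::real^'n. of_real (norm t ^ CARD('n)) :: complex) \<in> borel_measurable lebesgue"
    "indicator {t::real^'n. norm x \<le> norm t} \<in> borel_measurable lebesgue"
    by (rule borel_imp_lebesgue_measurable, measurable)+
  have le: "(\<integral>\<^sup>+ t. norm (?g t) \<partial>lebesgue) \<le> (\<integral>\<^sup>+ t. ennreal (norm (f t)) * dual_hardy_kernel s t \<partial>lebesgue)"
  proof (rule nn_integral_mono)
    fix t :: "real ^ 'n"
    have "ennreal (norm (f t) / norm t ^ CARD('n)) = ennreal (norm (f t)) * ennreal (1 / norm t ^ CARD('n))"
      by (subst ennreal_mult[symmetric]) auto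
    then show "ennreal (norm (?g t)) \<le> ennreal (norm (f t)) * dual_hardy_kernel s t"
      using s by (auto simp: dual_hardy_kernel_def indicator_def norm_divide norm_power)
  qed
  have "?g \<in> borel_measurable lebesgue" by measurable
  then have int: "integrable lebesgue ?g"
    using le fin by (auto simp: integrable_iff_bounded intro: le_less_trans)
  then show "dual_hardy_defined_at f x"
    by (simp add: dual_hardy_defined_at_def set_integrable_def)
  show "ennreal (norm (dual_hardy f x)) \<le> (\<integral>\<^sup>+ t. ennreal (norm (f t)) * dual_hardy_kernel s t \<partial>lebesgue)"
    using integral_norm_bound_ennreal[OF int] le
    unfolding dual_hardy_def set_lebesgue_integral_def by (rule order_trans)
qed

text \<open>For any constant \<open>c\<close> the commutator equals \<open>b x - c\<close> times the
  operator on \<open>f\<close>, minus the operator on \<open>(b - c) * f\<close>. The splitting of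
  \<open>f * b\<close> into \<open>c * f\<close> and \<open>(b - c) * f\<close> also shows that the
  operator is defined on \<open>f * b\<close>.\<close>

lemma dual_hardy_commutator_norm_le:
  fixes f b :: "real ^ 'n::finite \<Rightarrow> complex"
  assumes [measurable]: "f \<in> borel_measurable lebesgue" "b \<in> borel_measurable lebesgue"
    and fin1: "(\<integral>\<^sup>+ t. ennreal (norm (f t)) * dual_hardy_kernel s t \<partial>lebesgue) < \<infinity>"
    and fin2: "(\<integral>\<^sup>+ t. ennreal (norm (b t - c)) * ennreal (norm (f t)) * dual_hardy_kernel s t \<partial>lebesgue) < \<infinity>"
    and s: "s \<le> norm x"
  shows "dual_hardy_defined_at f x" "dual_hardy_defined_at (\<lambda>t. f t * b t) x"
    and "ennreal (norm (dual_hardy_commutator b f x))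
      \<le> ennreal (norm (b x - c)) * (\<integral>\<^sup>+ t. ennreal (norm (f t)) * dual_hardy_kernel s t \<partial>lebesgue)
        + (\<integral>\<^sup>+ t. ennreal (norm (b t - c)) * ennreal (norm (f t)) * dual_hardy_kernel s t \<partial>lebesgue)"
proof -
  define g where "g t = (b t - c) * f t" for t
  have [measurable]: "g \<in> borel_measurable lebesgue"
    unfolding g_def[abs_def] by measurable
  have g: "ennreal (norm (g t)) = ennreal (norm (b t - c)) * ennreal (norm (f t))" for t
    by (simp add: g_def norm_mult ennreal_mult)
  note f = dual_hardy_norm_le[OF assms(1) fin1 s]
  note gg = dual_hardy_norm_le[of g, unfolded g, OF _ fin2 s]
  have g_def': "dual_hardy_defined_at g x"
    by (rule gg) measurable
  have eq: "f t * b t / of_real (norm t ^ CARD('n))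
      = c * (f t / of_real (norm t ^ CARD('n))) + g t / of_real (norm t ^ CARD('n))" for t
  proof -
    have "g t = f t * b t - c * f t" by (simp add: g_def algebra_simps)
    then show ?thesis by (simp add: diff_divide_distrib)
  qed
  have cf: "set_integrable lebesgue {t. norm t \<ge> norm x} (\<lambda>t. c * (f t / of_real (norm t ^ CARD('n))))"
    using f(1) unfolding dual_hardy_defined_at_def by (rule set_integrable_mult_right)
  show "dual_hardy_defined_at f x" by (fact f(1))
  show "dual_hardy_defined_at (\<lambda>t. f t * b t) x"
    using g_def' cf unfolding dual_hardy_defined_at_def eq by (intro set_integral_add)
  have "dual_hardy (\<lambda>t. f t * b t) x = c * dual_hardy f x + dual_hardy g x"
    using g_def' cf unfolding dual_hardy_def dual_hardy_defined_at_def eq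
    by (subst set_integral_add(2)) (simp_all only: set_integral_mult_right)
  then have "dual_hardy_commutator b f x = (b x - c) * dual_hardy f x - dual_hardy g x"
    by (simp add: dual_hardy_commutator_def algebra_simps)
  then have "norm (dual_hardy_commutator b f x) \<le> norm (b x - c) * norm (dual_hardy f x) + norm (dual_hardy g x)"
    by (metis norm_triangle_ineq4 norm_mult)
  then have "ennreal (norm (dual_hardy_commutator b f x))
      \<le> ennreal (norm (b x - c)) * ennreal (norm (dual_hardy f x)) + ennreal (norm (dual_hardy g x))"
    by (simp add: ennreal_leI flip: ennreal_mult ennreal_plus)
  also have "\<dots> \<le> ennreal (norm (b x - c)) * (\<integral>\<^sup>+ t. ennreal (norm (f t)) * dual_hardy_kernel s t \<partial>lebesgue)
        + (\<integral>\<^sup>+ t. ennreal (norm (b t - c)) * ennreal (norm (f t)) * dual_hardy_kernel s t \<partial>lebesgue)"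
    by (intro add_mono mult_left_mono f(2) gg(2)) simp_all
  finally show "ennreal (norm (dual_hardy_commutator b f x)) \<le> \<dots>" .
qed

section \<open>Averages over balls and the size of the denominators\<close>

lemma measure_ball_0:
  assumes "0 < r"
  shows "measure lebesgue (ball (0 :: real ^ 'n::finite) r)
    = measure lebesgue (ball (0 :: real ^ 'n) 1) * r powr real CARD('n)"
  using content_ball_conv_unit_ball[of r "0 :: real ^ 'n"] assms
  by (simp add: powr_realpow mult.commute)

lemma measure_ball_0_pos: "0 < r \<Longrightarrow> 0 < measure lebesgue (ball (0 :: real ^ 'n::finite) r)"
  using content_ball_pos[of r "0 :: real ^ 'n"] by simp

text \<open>The difference is the average of \<open>b - c\<close>. Finiteness makes \<open>b\<close>
  integrable on the ball, so \<open>ball_average\<close> is a true mean and not the default value of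
  a divergent integral.\<close>

lemma ball_average_diff_le:
  fixes b :: "real ^ 'n::finite \<Rightarrow> complex"
  assumes [measurable]: "b \<in> borel_measurable lebesgue" and "0 < r"
    and fin: "(\<integral>\<^sup>+ t. ennreal (norm (b t - c)) * indicator (ball 0 r) t \<partial>lebesgue) < \<infinity>"
  shows "ennreal (norm (ball_average b r - c))
    \<le> ennreal (1 / measure lebesgue (ball (0 :: real ^ 'n) r))
      * (\<integral>\<^sup>+ t. ennreal (norm (b t - c)) * indicator (ball 0 r) t \<partial>lebesgue)"
proof -
  let ?m = "measure lebesgue (ball (0 :: real ^ 'n) r)"
  have m: "0 < ?m" using assms(2) by (rule measure_ball_0_pos)
  have eq: "ennreal (norm (indicator (ball 0 r) t *\<^sub>R (b t - c))) = ennreal (norm (b t - c)) * indicator (ball 0 r) t" for t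
    by (simp add: indicator_def)
  have int: "integrable lebesgue (\<lambda>t. indicator (ball 0 r) t *\<^sub>R (b t - c))"
    unfolding integrable_iff_bounded eq using fin by simp
  have c: "set_integrable lebesgue (ball (0 :: real ^ 'n) r) (\<lambda>_. c)"
    unfolding set_integrable_def by (intro integrable_scaleR_left integrable_real_indicator) (simp_all add: emeasure_lborel_ball_finite[unfolded infinity_ennreal_def])
  have "(LINT t:ball 0 r|lebesgue. b t) = (LINT t:ball 0 r|lebesgue. (b t - c) + c)"
    by simp
  also have "\<dots> = (LINT t:ball 0 r|lebesgue. b t - c) + (LINT t:ball (0 :: real ^ 'n) r|lebesgue. c)"
    using int c by (intro set_integral_add) (simp_all add: set_integrable_def)
  also have "(LINT t:ball (0 :: real ^ 'n) r|lebesgue. c) = ?m *\<^sub>R c"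
    unfolding set_lebesgue_integral_def by (subst integral_scaleR_left) (auto simp: emeasure_lborel_ball_finite[unfolded infinity_ennreal_def])
  finally have "ball_average b r - c = (1 / ?m) *\<^sub>R (LINT t:ball 0 r|lebesgue. b t - c)"
    using m by (simp add: ball_average_def scaleR_add_right)
  then have "ennreal (norm (ball_average b r - c)) = ennreal (1 / ?m) * ennreal (norm (LINT t:ball 0 r|lebesgue. b t - c))"
    using m by (simp flip: ennreal_mult)
  also have "\<dots> \<le> ennreal (1 / ?m) * (\<integral>\<^sup>+ t. ennreal (norm (b t - c)) * indicator (ball 0 r) t \<partial>lebesgue)"
    using integral_norm_bound_ennreal[OF int] unfolding eq set_lebesgue_integral_def
    by (intro mult_left_mono) auto
  finally show ?thesis .
qed

text \<open>Hoelder's inequality against the indicator of the ball in the conjugate exponents, whose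
  reciprocals sum to \<open>n\<close> minus the sum of the \<open>1 / p $ i\<close>.\<close>

lemma nn_integral_ball_le_mixed_nn_norm:
  fixes p :: "real ^ 'n::{finite,linorder}"
  assumes p: "\<And>i. 1 < p $ i" and [measurable]: "F \<in> borel_measurable lebesgue" and "0 < r"
  shows "(\<integral>\<^sup>+ t. F t * indicator (ball 0 r) t \<partial>lebesgue)
    \<le> mixed_nn_norm p (\<lambda>t. F t * indicator (ball 0 r) t)
      * ennreal (2 powr (real CARD('n) - (\<Sum>i\<in>UNIV. 1 / p $ i)) * r powr (real CARD('n) - (\<Sum>i\<in>UNIV. 1 / p $ i)))"
proof -
  define p' where "p' = (\<chi> i. p $ i / (p $ i - 1))"
  have p0: "0 < p $ i" for i
    using p[of i] by linarith
  have p': "0 < p' $ i" "1 / p' $ i = 1 - 1 / p $ i" for i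
    using p[of i] by (auto simp: p'_def field_simps)
  have sum: "(\<Sum>i\<in>UNIV. 1 / p' $ i) = real CARD('n) - (\<Sum>i\<in>UNIV. 1 / p $ i)"
    by (simp add: p' sum_subtractf)
  \<comment> \<open>The indicator is doubled: one copy stays with \<open>F\<close>, the other is the
    second Hoelder factor.\<close>
  have "(\<integral>\<^sup>+ t. F t * indicator (ball 0 r) t \<partial>lebesgue)
      = (\<integral>\<^sup>+ t. (F t * indicator (ball 0 r) t) * indicator (ball 0 r) t \<partial>lebesgue)"
    by (intro nn_integral_cong) (simp split: split_indicator)
  also have "\<dots> = mixed_nn_norm (\<chi> i. 1) (\<lambda>t. (F t * indicator (ball 0 r) t) * indicator (ball 0 r) t)"
    by (rule mixed_nn_norm_1[symmetric]) measurable
  also have "\<dots> \<le> mixed_nn_norm p (\<lambda>t. F t * indicator (ball 0 r) t) * mixed_nn_norm p' (indicator (ball 0 r))"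
    using p0 p' by (intro mixed_nn_norm_holder) simp_all
  also have "\<dots> \<le> mixed_nn_norm p (\<lambda>t. F t * indicator (ball 0 r) t)
      * ennreal (2 powr (\<Sum>i\<in>UNIV. 1 / p' $ i) * r powr (\<Sum>i\<in>UNIV. 1 / p' $ i))"
    using p'(1) assms(3) by (intro mult_left_mono mixed_nn_norm_ball_le) simp_all
  finally show ?thesis unfolding sum .
qed

lemma norm_mult_indicator:
  "ennreal (norm (f x * indicator A x)) = ennreal (norm (f x)) * indicator A x" for f :: "'a \<Rightarrow> complex"
  by (simp add: indicator_def)

lemma mixed_norm_indicator: "mixed_norm p (indicator A) = mixed_nn_norm p (indicator A)"
proof -
  have "ennreal (norm (indicator A x :: complex)) = indicator A x" for x
    by (simp add: indicator_def)
  then show ?thesis by (simp add: mixed_norm_eq)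
qed

text \<open>Both central norms are suprema of quotients with this denominator, which has order
  \<open>r\<close> to the power \<open>n * l\<close> plus the sum of the \<open>1 / p $ i\<close>.
  \<open>C\<close> is fixed before \<open>r\<close>, \<open>X\<close> and \<open>K\<close>; this is
  the origin of a final constant independent of \<open>b\<close> and \<open>f\<close>.\<close>

lemma central_quotient_leD:
  fixes p :: "real ^ 'n::{finite,linorder}"
  assumes p: "\<And>i. 0 < p $ i"
  obtains C where "0 < C" and "\<And>r X K. \<lbrakk>0 < r;
      X / (ennreal (measure lebesgue (ball (0 :: real ^ 'n::{finite,linorder}) r) powr l) * mixed_norm p (indicator (ball 0 r))) \<le> K\<rbrakk>
    \<Longrightarrow> X \<le> ennreal (C * r powr (real CARD('n) * l + (\<Sum>i\<in>UNIV. 1 / p $ i))) * K"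
proof -
  let ?s = "\<Sum>i\<in>UNIV. 1 / p $ i"
  define v where "v = measure lebesgue (ball (0 :: real ^ 'n::{finite,linorder}) 1)"
  have v: "0 < v" unfolding v_def by (rule measure_ball_0_pos) simp
  show ?thesis
  proof (rule that[of "v powr l * 2 powr ?s"])
    fix r :: real and X K :: ennreal
    let ?D = "ennreal (measure lebesgue (ball (0 :: real ^ 'n::{finite,linorder}) r) powr l) * mixed_norm p (indicator (ball 0 r))"
    assume r: "0 < r" and le: "X / ?D \<le> K"
    have "?D \<le> ennreal ((v * r powr real CARD('n)) powr l) * ennreal (2 powr ?s * r powr ?s)"
      unfolding measure_ball_0[OF r] v_def mixed_norm_indicator
      using r p by (intro mult_left_mono mixed_nn_norm_ball_le) simp_all
    also have "\<dots> = ennreal (v powr l * 2 powr ?s * r powr (real CARD('n) * l + ?s))"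
      using v r by (simp add: powr_mult powr_powr powr_add mult_ac flip: ennreal_mult)
    finally have D: "?D \<le> ennreal (v powr l * 2 powr ?s * r powr (real CARD('n) * l + ?s))" .
    then have "?D < top"
      by (rule le_less_trans) simp
    moreover have "?D \<noteq> 0"
    proof -
      have "0 < ennreal ((1 / real CARD('n)) powr ?s * r powr ?s)"
        using r by simp
      also have "\<dots> \<le> mixed_norm p (indicator (ball 0 r))"
        unfolding mixed_norm_indicator by (rule mixed_nn_norm_ball_ge[OF p r])
      finally show ?thesis
        using measure_ball_0_pos[OF r, where 'n = 'n] by simp
    qed
    \<comment> \<open>Undoing the division in \<open>ennreal\<close> requires a denominator that is
      neither 0 nor \<open>top\<close>.\<close>
    ultimately have "X = X / ?D * ?D"
      by (simp add: ennreal_divide_times ennreal_divide_self)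
    also have "\<dots> \<le> K * ennreal (v powr l * 2 powr ?s * r powr (real CARD('n) * l + ?s))"
      by (intro mult_mono le D) simp_all
    finally show "X \<le> ennreal (v powr l * 2 powr ?s * r powr (real CARD('n) * l + ?s)) * K"
      by (simp add: mult.commute)
  qed (use v in simp)
qed

text \<open>The converse passage uses the lower bound for the denominator, hence the inscribed
  cube.\<close>

lemma central_quotient_leI:
  fixes p :: "real ^ 'n::{finite,linorder}"
  assumes p: "\<And>i. 0 < p $ i"
  obtains C where "0 < C" and "\<And>r X K. \<lbrakk>0 < r;
      X \<le> ennreal (r powr (real CARD('n) * l + (\<Sum>i\<in>UNIV. 1 / p $ i))) * K\<rbrakk>
    \<Longrightarrow> X / (ennreal (measure lebesgue (ball (0 :: real ^ 'n::{finite,linorder}) r) powr l) * mixed_norm p (indicator (ball 0 r)))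
      \<le> ennreal C * K"
proof -
  let ?s = "\<Sum>i\<in>UNIV. 1 / p $ i"
  define v where "v = measure lebesgue (ball (0 :: real ^ 'n::{finite,linorder}) 1)"
  have v: "0 < v" unfolding v_def by (rule measure_ball_0_pos) simp
  define d where "d = v powr l * (1 / real CARD('n)) powr ?s"
  have d: "0 < d" using v by (simp add: d_def)
  show ?thesis
  proof (rule that[of "1 / d"])
    fix r :: real and X K :: ennreal
    let ?D = "ennreal (measure lebesgue (ball (0 :: real ^ 'n::{finite,linorder}) r) powr l) * mixed_norm p (indicator (ball 0 r))"
    let ?e = "real CARD('n) * l + ?s"
    assume r: "0 < r" and le: "X \<le> ennreal (r powr ?e) * K"
    have "ennreal (d * r powr ?e)
        = ennreal ((v * r powr real CARD('n)) powr l) * ennreal ((1 / real CARD('n)) powr ?s * r powr ?s)"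
      using v r by (simp add: d_def powr_mult powr_powr powr_add mult_ac flip: ennreal_mult)
    also have "\<dots> \<le> ?D"
      unfolding measure_ball_0[OF r] v_def mixed_norm_indicator
      using r p by (intro mult_left_mono mixed_nn_norm_ball_ge) simp_all
    finally have D: "ennreal (d * r powr ?e) \<le> ?D" .
    have "0 < ennreal (d * r powr ?e)" using d r by simp
    then have "0 < ?D" using D by (rule less_le_trans)
    then show "X / ?D \<le> ennreal (1 / d) * K"
    proof (rule divide_le_posI_ennreal)
      have "ennreal (r powr ?e) * K = ennreal (d * r powr ?e) * (ennreal (1 / d) * K)"
        using d by (subst ennreal_mult_left) auto
      also have "\<dots> \<le> ?D * (ennreal (1 / d) * K)"
        by (intro mult_right_mono D) simp
      finally show "X \<le> ?D * (ennreal (1 / d) * K)" using le by (rule order_trans[rotated])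
    qed
  qed (use d in simp)
qed

section \<open>Dyadic decompositions\<close>

text \<open>Telescoping over \<open>j\<close> doublings; since \<open>e2 \<ge> 0\<close>, each step
  is at most the bound at the largest radius.\<close>

lemma dyadic_average_drift:
  fixes \<beta> :: "real \<Rightarrow> complex"
  assumes "0 \<le> A" "0 \<le> e2" "0 < r"
    and step: "\<And>r. 0 < r \<Longrightarrow> ennreal (norm (\<beta> r - \<beta> (2 * r))) \<le> ennreal (A * r powr e2) * Kb"
  shows "ennreal (norm (\<beta> r - \<beta> (r * 2 ^ j))) \<le> ennreal (A * real j * (r * 2 ^ j) powr e2) * Kb"
proof (induction j)
  case (Suc j)
  let ?s = "r * 2 ^ j"
  have s: "0 < ?s" using assms(3) by simp
  have "norm (\<beta> r - \<beta> (2 * ?s)) \<le> norm (\<beta> r - \<beta> ?s) + norm (\<beta> ?s - \<beta> (2 * ?s))"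
    by norm
  then have "ennreal (norm (\<beta> r - \<beta> (2 * ?s))) \<le> ennreal (norm (\<beta> r - \<beta> ?s)) + ennreal (norm (\<beta> ?s - \<beta> (2 * ?s)))"
    by (simp add: ennreal_leI flip: ennreal_plus)
  also have "\<dots> \<le> ennreal (A * real j * ?s powr e2) * Kb + ennreal (A * ?s powr e2) * Kb"
    by (intro add_mono Suc.IH step s)
  also have "\<dots> = ennreal (A * real j * ?s powr e2 + A * ?s powr e2) * Kb"
    using assms(1) by (simp add: distrib_right)
  also have "\<dots> \<le> ennreal (A * real (Suc j) * (2 * ?s) powr e2) * Kb"
  proof (intro mult_right_mono ennreal_leI)
    have "A * real j * ?s powr e2 + A * ?s powr e2 = A * real (Suc j) * ?s powr e2"
      by (simp add: algebra_simps)
    also have "\<dots> \<le> A * real (Suc j) * (2 * ?s) powr e2"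
      using assms(1,2) s by (intro mult_left_mono powr_mono2) auto
    finally show "A * real j * ?s powr e2 + A * ?s powr e2 \<le> A * real (Suc j) * (2 * ?s) powr e2" .
  qed simp
  finally show ?case by (simp add: mult_ac)
qed simp

text \<open>On the large ball \<open>\<beta> r\<close> is exchanged for the average
  \<open>\<beta> (r * 2 ^ j)\<close> of that ball. The oscillation around the latter contributes
  \<open>A\<close>; the drift times the mean of \<open>f\<close> contributes \<open>A^2 * j\<close>
  at the same power of the radius.\<close>

lemma nn_integral_oscillation_le:
  fixes f b :: "real ^ 'n::finite \<Rightarrow> complex"
  assumes [measurable]: "f \<in> borel_measurable lebesgue" "b \<in> borel_measurable lebesgue"
    and A: "0 \<le> A" and e2: "0 \<le> e2" and r: "0 < r"
    and mean: "\<And>r. 0 < r \<Longrightarrow> (\<integral>\<^sup>+ t. ennreal (norm (f t)) * indicator (ball 0 r) t \<partial>lebesgue)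
      \<le> ennreal (A * r powr (real CARD('n) + e1)) * Kf"
    and osc: "\<And>r. 0 < r \<Longrightarrow>
      (\<integral>\<^sup>+ t. ennreal (norm (b t - \<beta> r)) * ennreal (norm (f t)) * indicator (ball 0 r) t \<partial>lebesgue)
      \<le> ennreal (A * r powr (real CARD('n) + (e1 + e2))) * (Kb * Kf)"
    and step: "\<And>r. 0 < r \<Longrightarrow> ennreal (norm (\<beta> r - \<beta> (2 * r))) \<le> ennreal (A * r powr e2) * Kb"
  shows "(\<integral>\<^sup>+ t. ennreal (norm (b t - \<beta> r)) * ennreal (norm (f t)) * indicator (ball 0 (r * 2 ^ j)) t \<partial>lebesgue)
    \<le> ennreal ((A + A\<^sup>2) * real (Suc j) * (r * 2 ^ j) powr (real CARD('n) + (e1 + e2))) * (Kb * Kf)"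
proof -
  let ?s = "r * 2 ^ j" and ?n = "real CARD('n)"
  have s: "0 < ?s" using r by simp
  have "(\<integral>\<^sup>+ t. ennreal (norm (b t - \<beta> r)) * ennreal (norm (f t)) * indicator (ball 0 ?s) t \<partial>lebesgue)
      \<le> (\<integral>\<^sup>+ t. ennreal (norm (b t - \<beta> ?s)) * ennreal (norm (f t)) * indicator (ball 0 ?s) t
          + ennreal (norm (\<beta> r - \<beta> ?s)) * (ennreal (norm (f t)) * indicator (ball 0 ?s) t) \<partial>lebesgue)"
  proof (rule nn_integral_mono)
    fix t :: "real ^ 'n"
    have "norm (b t - \<beta> r) \<le> norm (b t - \<beta> ?s) + norm (\<beta> r - \<beta> ?s)"
      by norm
    then have "ennreal (norm (b t - \<beta> r)) \<le> ennreal (norm (b t - \<beta> ?s)) + ennreal (norm (\<beta> r - \<beta> ?s))"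
      by (simp add: ennreal_leI flip: ennreal_plus)
    then have "ennreal (norm (b t - \<beta> r)) * (ennreal (norm (f t)) * indicator (ball 0 ?s) t)
        \<le> (ennreal (norm (b t - \<beta> ?s)) + ennreal (norm (\<beta> r - \<beta> ?s))) * (ennreal (norm (f t)) * indicator (ball 0 ?s) t)"
      by (rule mult_right_mono) simp
    then show "ennreal (norm (b t - \<beta> r)) * ennreal (norm (f t)) * indicator (ball 0 ?s) t
        \<le> ennreal (norm (b t - \<beta> ?s)) * ennreal (norm (f t)) * indicator (ball 0 ?s) t
          + ennreal (norm (\<beta> r - \<beta> ?s)) * (ennreal (norm (f t)) * indicator (ball 0 ?s) t)"
      by (simp only: distrib_right mult.assoc)
  qed
  also have "\<dots> = (\<integral>\<^sup>+ t. ennreal (norm (b t - \<beta> ?s)) * ennreal (norm (f t)) * indicator (ball 0 ?s) t \<partial>lebesgue)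
      + ennreal (norm (\<beta> r - \<beta> ?s)) * (\<integral>\<^sup>+ t. ennreal (norm (f t)) * indicator (ball 0 ?s) t \<partial>lebesgue)"
    by (subst nn_integral_add, measurable) (simp add: nn_integral_cmult)
  also have "\<dots> \<le> ennreal (A * ?s powr (?n + (e1 + e2))) * (Kb * Kf)
      + ennreal (A * real j * ?s powr e2) * Kb * (ennreal (A * ?s powr (?n + e1)) * Kf)"
    by (intro add_mono osc s mult_mono mean dyadic_average_drift[OF A e2 r step]) simp_all
  also have "\<dots> = ennreal (A * ?s powr (?n + (e1 + e2)) + A * real j * ?s powr e2 * (A * ?s powr (?n + e1))) * (Kb * Kf)"
    using A by (simp add: ennreal_mult distrib_left distrib_right mult_ac)
  also have "A * ?s powr (?n + (e1 + e2)) + A * real j * ?s powr e2 * (A * ?s powr (?n + e1))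
      = (A + A\<^sup>2 * real j) * ?s powr (?n + (e1 + e2))"
    by (simp add: powr_add power2_eq_square algebra_simps)
  also have "ennreal \<dots> * (Kb * Kf) \<le> ennreal ((A + A\<^sup>2) * real (Suc j) * ?s powr (?n + (e1 + e2))) * (Kb * Kf)"
  proof (intro mult_right_mono ennreal_leI)
    show "A + A\<^sup>2 * real j \<le> (A + A\<^sup>2) * real (Suc j)"
      using A by (simp add: algebra_simps)
  qed simp_all
  finally show ?thesis .
qed

text \<open>Each shell is compared with its own average, so no drift occurs. Both terms of
  \<open>point\<close> contribute \<open>A * B\<close> times the same power of the shell radius,
  whence the factor 2, and halving the radius multiplies by
  \<open>2 powr - (e1 + e2 + s) < 1\<close>.\<close>

lemma mixed_nn_norm_dyadic_shells:
  fixes h :: "real ^ 'n::{finite,linorder} \<Rightarrow> ennreal" and b :: "real ^ 'n::{finite,linorder} \<Rightarrow> complex"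
  assumes q: "\<And>i. 1 < q $ i" and [measurable]: "b \<in> borel_measurable lebesgue"
    and A: "0 \<le> A" and B: "0 \<le> B" and pos: "0 < e1 + e2 + s" and r: "0 < r"
    and point: "\<And>\<rho> x. \<lbrakk>0 < \<rho>; \<rho> / 2 \<le> norm x; norm x < \<rho>\<rbrakk> \<Longrightarrow>
      h x \<le> ennreal (norm (b x - \<beta> \<rho>)) * (ennreal (A * \<rho> powr e1) * Kf) + ennreal (A * \<rho> powr (e1 + e2)) * (Kb * Kf)"
    and osc: "\<And>\<rho>. 0 < \<rho> \<Longrightarrow> mixed_nn_norm q (\<lambda>x. ennreal (norm (b x - \<beta> \<rho>)) * indicator (ball 0 \<rho>) x)
      \<le> ennreal (B * \<rho> powr (e2 + s)) * Kb"
    and ball: "\<And>\<rho>. 0 < \<rho> \<Longrightarrow> mixed_nn_norm q (indicator (ball 0 \<rho>)) \<le> ennreal (B * \<rho> powr s)"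
  shows "mixed_nn_norm q (\<lambda>x. h x * indicator (ball 0 r) x)
    \<le> ennreal (2 * A * B / (1 - 2 powr - (e1 + e2 + s)) * r powr (e1 + e2 + s)) * (Kb * Kf)"
proof -
  have q0: "0 < q $ i" for i
    using q[of i] by linarith
  let ?\<rho> = "\<lambda>m. r / 2 ^ m" and ?e = "e1 + e2 + s"
  have \<rho>: "0 < ?\<rho> m" for m using r by simp
  define F where "F m x = ennreal (A * ?\<rho> m powr e1) * Kf * (ennreal (norm (b x - \<beta> (?\<rho> m))) * indicator (ball 0 (?\<rho> m)) x)" for m x
  define G where "G m x = ennreal (A * ?\<rho> m powr (e1 + e2)) * (Kb * Kf) * indicator (ball 0 (?\<rho> m)) x" for m and x :: "real ^ 'n::{finite,linorder}"
  have [measurable]: "F m \<in> borel_measurable lebesgue" "G m \<in> borel_measurable lebesgue" for m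
    unfolding F_def[abs_def] G_def[abs_def] by measurable
  have le: "h x * indicator (ball 0 r) x \<le> (\<Sum>m. F m x + G m x)" if "x \<noteq> 0" for x
  proof (cases "norm x < r")
    case True
    obtain k where "r / norm x < 2 ^ k"
      using real_arch_pow[of 2 "r / norm x"] by auto
    then have k: "?\<rho> (Suc k) \<le> norm x"
      using that r by (simp add: field_simps)
    \<comment> \<open>The index of the shell containing \<open>x\<close>, found from its inner
      radius \<open>r / 2 ^ Suc m\<close>. Minimality gives the outer radius, and for
      \<open>m = 0\<close> this is \<open>norm x < r\<close>.\<close>
    define m where "m = (LEAST m. ?\<rho> (Suc m) \<le> norm x)"
    have m: "?\<rho> (Suc m) \<le> norm x"
      unfolding m_def using k by (rule LeastI)
    have "norm x < ?\<rho> m"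
    proof (cases m)
      case (Suc i)
      then have "\<not> ?\<rho> (Suc i) \<le> norm x"
        unfolding m_def by (intro not_less_Least) simp
      then show ?thesis using Suc by simp
    qed (use True in simp)
    then have "h x \<le> (\<Sum>m\<in>{m}. F m x + G m x)"
      using point[OF \<rho>[of m], of x] m by (simp add: F_def G_def mult_ac)
    also have "\<dots> \<le> (\<Sum>m. F m x + G m x)"
      by (rule sum_le_suminf) auto
    finally show ?thesis using True by simp
  qed simp
  \<comment> \<open>The origin lies in no shell, so the domination holds only almost
    everywhere.\<close>
  have "AE x :: real ^ 'n::{finite,linorder} in lebesgue. x \<noteq> 0"
    by (simp add: AE_completion_iff AE_lborel_singleton)
  then have "AE x in lebesgue. h x * indicator (ball 0 r) x \<le> (\<Sum>m. F m x + G m x)"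
    by eventually_elim (rule le)
  then have "mixed_nn_norm q (\<lambda>x. h x * indicator (ball 0 r) x) \<le> mixed_nn_norm q (\<lambda>x. \<Sum>m. F m x + G m x)"
    using q0 by (rule mixed_nn_norm_mono_AE)
  also have "\<dots> \<le> (\<Sum>m. mixed_nn_norm q (\<lambda>x. F m x + G m x))"
    using q by (rule mixed_nn_norm_suminf) measurable
  also have "\<dots> \<le> (\<Sum>m. ennreal (2 * A * B * r powr ?e * (2 powr - ?e) ^ m) * (Kb * Kf))"
  proof (intro suminf_le summableI)
    fix m
    have "mixed_nn_norm q (\<lambda>x. F m x + G m x) \<le> mixed_nn_norm q (F m) + mixed_nn_norm q (G m)"
      using q by (rule mixed_nn_norm_add) measurable
    also have "mixed_nn_norm q (F m) = ennreal (A * ?\<rho> m powr e1) * Kf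
        * mixed_nn_norm q (\<lambda>x. ennreal (norm (b x - \<beta> (?\<rho> m))) * indicator (ball 0 (?\<rho> m)) x)"
      unfolding F_def using q0 by (rule mixed_nn_norm_cmult) measurable
    also have "mixed_nn_norm q (G m) = ennreal (A * ?\<rho> m powr (e1 + e2)) * (Kb * Kf) * mixed_nn_norm q (indicator (ball 0 (?\<rho> m)))"
      unfolding G_def using q0 by (rule mixed_nn_norm_cmult) measurable
    also have "ennreal (A * ?\<rho> m powr e1) * Kf
        * mixed_nn_norm q (\<lambda>x. ennreal (norm (b x - \<beta> (?\<rho> m))) * indicator (ball 0 (?\<rho> m)) x)
        + ennreal (A * ?\<rho> m powr (e1 + e2)) * (Kb * Kf) * mixed_nn_norm q (indicator (ball 0 (?\<rho> m)))
      \<le> ennreal (A * ?\<rho> m powr e1) * Kf * (ennreal (B * ?\<rho> m powr (e2 + s)) * Kb)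
        + ennreal (A * ?\<rho> m powr (e1 + e2)) * (Kb * Kf) * ennreal (B * ?\<rho> m powr s)"
      by (intro add_mono mult_left_mono osc ball \<rho>) simp_all
    also have "\<dots> = ennreal (A * ?\<rho> m powr e1 * (B * ?\<rho> m powr (e2 + s)) + A * ?\<rho> m powr (e1 + e2) * (B * ?\<rho> m powr s)) * (Kb * Kf)"
      using A B by (simp add: ennreal_mult distrib_left distrib_right mult_ac)
    also have "A * ?\<rho> m powr e1 * (B * ?\<rho> m powr (e2 + s)) + A * ?\<rho> m powr (e1 + e2) * (B * ?\<rho> m powr s)
        = 2 * A * B * ?\<rho> m powr ?e"
      by (simp add: powr_add mult_ac)
    also have "?\<rho> m powr ?e = r powr ?e * (2 powr - ?e) ^ m"
      using r by (rule powr_dyadic(2))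
    finally show "mixed_nn_norm q (\<lambda>x. F m x + G m x) \<le> ennreal (2 * A * B * r powr ?e * (2 powr - ?e) ^ m) * (Kb * Kf)"
      by (simp add: mult.assoc)
  qed
  also have "\<dots> = ennreal (2 * A * B * r powr ?e * (1 / (1 - 2 powr - ?e))) * (Kb * Kf)"
  proof -
    have "(2 :: real) powr - ?e < 1"
      using pos by (intro powr_less_one) auto
    then have "(\<lambda>m. (2 powr - ?e) ^ m) sums (1 / (1 - 2 powr - ?e))"
      by (intro geometric_sums) simp
    from sums_mult[OF this, of "2 * A * B * r powr ?e"] show ?thesis
      using A B by (simp only: ennreal_suminf_multc) (subst suminf_ennreal_eq, auto)
  qed
  finally show ?thesis by (simp add: mult_ac)
qed

section \<open>The commutator estimate\<close>

lemma central_morrey_norm_bound: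
  fixes p :: "real ^ 'n::{finite,linorder}"
  assumes p: "\<And>i. 0 < p $ i"
  obtains C where "0 < C" and "\<And>r f. 0 < r \<Longrightarrow> mixed_nn_norm p (\<lambda>x. ennreal (norm (f x)) * indicator (ball 0 r) x)
    \<le> ennreal (C * r powr (real CARD('n) * l + (\<Sum>i\<in>UNIV. 1 / p $ i))) * central_morrey_norm p l f"
proof -
  obtain C where C: "0 < C" "\<And>r X K. \<lbrakk>0 < r;
      X / (ennreal (measure lebesgue (ball (0 :: real ^ 'n::{finite,linorder}) r) powr l) * mixed_norm p (indicator (ball 0 r))) \<le> K\<rbrakk>
    \<Longrightarrow> X \<le> ennreal (C * r powr (real CARD('n) * l + (\<Sum>i\<in>UNIV. 1 / p $ i))) * K"
    by (rule central_quotient_leD[OF p, where l = l]) blast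
  show ?thesis
  proof (rule that[OF C(1)])
    fix r :: real and f :: "real ^ 'n::{finite,linorder} \<Rightarrow> complex"
    assume r: "0 < r"
    show "mixed_nn_norm p (\<lambda>x. ennreal (norm (f x)) * indicator (ball 0 r) x)
      \<le> ennreal (C * r powr (real CARD('n) * l + (\<Sum>i\<in>UNIV. 1 / p $ i))) * central_morrey_norm p l f"
      unfolding norm_mult_indicator[symmetric] mixed_norm_eq[symmetric]
    proof (rule C(2)[OF r])
      show "mixed_norm p (\<lambda>x. f x * indicator (ball 0 r) x)
        / (ennreal (measure lebesgue (ball (0 :: real ^ 'n::{finite,linorder}) r) powr l) * mixed_norm p (indicator (ball 0 r)))
        \<le> central_morrey_norm p l f"
        unfolding central_morrey_norm_def using r by (intro SUP_upper2[of r]) simp_all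
    qed
  qed
qed

lemma cbmo_norm_bound:
  fixes p :: "real ^ 'n::{finite,linorder}"
  assumes p: "\<And>i. 0 < p $ i"
  obtains C where "0 < C" and "\<And>r b. 0 < r \<Longrightarrow>
    mixed_nn_norm p (\<lambda>x. ennreal (norm (b x - ball_average b r)) * indicator (ball 0 r) x)
    \<le> ennreal (C * r powr (real CARD('n) * l + (\<Sum>i\<in>UNIV. 1 / p $ i))) * cbmo_norm p l b"
proof -
  obtain C where C: "0 < C" "\<And>r X K. \<lbrakk>0 < r;
      X / (ennreal (measure lebesgue (ball (0 :: real ^ 'n::{finite,linorder}) r) powr l) * mixed_norm p (indicator (ball 0 r))) \<le> K\<rbrakk>
    \<Longrightarrow> X \<le> ennreal (C * r powr (real CARD('n) * l + (\<Sum>i\<in>UNIV. 1 / p $ i))) * K"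
    by (rule central_quotient_leD[OF p, where l = l]) blast
  show ?thesis
  proof (rule that[OF C(1)])
    fix r :: real and b :: "real ^ 'n::{finite,linorder} \<Rightarrow> complex"
    assume r: "0 < r"
    show "mixed_nn_norm p (\<lambda>x. ennreal (norm (b x - ball_average b r)) * indicator (ball 0 r) x)
      \<le> ennreal (C * r powr (real CARD('n) * l + (\<Sum>i\<in>UNIV. 1 / p $ i))) * cbmo_norm p l b"
      unfolding norm_mult_indicator[of "\<lambda>x. b x - ball_average b r", symmetric] mixed_norm_eq[symmetric]
    proof (rule C(2)[OF r])
      show "mixed_norm p (\<lambda>x. (b x - ball_average b r) * indicator (ball 0 r) x)
        / (ennreal (measure lebesgue (ball (0 :: real ^ 'n::{finite,linorder}) r) powr l) * mixed_norm p (indicator (ball 0 r)))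
        \<le> cbmo_norm p l b"
        unfolding cbmo_norm_def using r by (intro SUP_upper2[of r]) simp_all
    qed
  qed
qed

lemma central_morrey_mean_bound:
  fixes p :: "real ^ 'n::{finite,linorder}"
  assumes p: "\<And>i. 1 < p $ i"
  obtains A where "0 < A" and "\<And>r f. \<lbrakk>0 < r; f \<in> borel_measurable lebesgue\<rbrakk> \<Longrightarrow>
    (\<integral>\<^sup>+ t. ennreal (norm (f t)) * indicator (ball 0 r) t \<partial>lebesgue)
    \<le> ennreal (A * r powr (real CARD('n) + real CARD('n) * l)) * central_morrey_norm p l f"
proof -
  have p0: "0 < p $ i" for i
    using p[of i] by linarith
  let ?s = "\<Sum>i\<in>UNIV. 1 / p $ i" and ?n = "real CARD('n)"
  obtain C where C: "0 < C" "\<And>r f. 0 < r \<Longrightarrow> mixed_nn_norm p (\<lambda>x. ennreal (norm (f x)) * indicator (ball 0 r) x)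
      \<le> ennreal (C * r powr (?n * l + ?s)) * central_morrey_norm p l f"
    by (rule central_morrey_norm_bound[OF p0, where l = l]) blast
  show ?thesis
  proof (rule that[of "C * 2 powr (?n - ?s)"])
    fix r :: real and f :: "real ^ 'n::{finite,linorder} \<Rightarrow> complex"
    assume r: "0 < r" and [measurable]: "f \<in> borel_measurable lebesgue"
    have "(\<integral>\<^sup>+ t. ennreal (norm (f t)) * indicator (ball 0 r) t \<partial>lebesgue)
        \<le> mixed_nn_norm p (\<lambda>t. ennreal (norm (f t)) * indicator (ball 0 r) t) * ennreal (2 powr (?n - ?s) * r powr (?n - ?s))"
      using p _ r by (rule nn_integral_ball_le_mixed_nn_norm) measurable
    also have "\<dots> \<le> ennreal (C * r powr (?n * l + ?s)) * central_morrey_norm p l f * ennreal (2 powr (?n - ?s) * r powr (?n - ?s))"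
      by (intro mult_right_mono C r) simp
    also have "\<dots> = ennreal (C * r powr (?n * l + ?s) * (2 powr (?n - ?s) * r powr (?n - ?s))) * central_morrey_norm p l f"
      using C(1) by (simp add: ennreal_mult mult_ac)
    also have "C * r powr (?n * l + ?s) * (2 powr (?n - ?s) * r powr (?n - ?s)) = C * 2 powr (?n - ?s) * r powr (?n + ?n * l)"
    proof -
      have "r powr (?n * l + ?s) * r powr (?n - ?s) = r powr (?n + ?n * l)"
        unfolding powr_add[symmetric] by (simp add: add.commute)
      then show ?thesis by (simp add: mult_ac)
    qed
    finally show "(\<integral>\<^sup>+ t. ennreal (norm (f t)) * indicator (ball 0 r) t \<partial>lebesgue)
      \<le> ennreal (C * 2 powr (?n - ?s) * r powr (?n + ?n * l)) * central_morrey_norm p l f" .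
  qed (use C in simp)
qed

text \<open>The smaller ball lies in the larger one, so the mean over it of the distance of
  \<open>b\<close> to the larger average is at most a fixed multiple of the oscillation at radius
  \<open>2 * r\<close>.\<close>

lemma ball_average_doubling:
  fixes p :: "real ^ 'n::{finite,linorder}"
  assumes p: "\<And>i. 1 < p $ i"
  obtains A where "0 < A" and "\<And>r b. \<lbrakk>0 < r; b \<in> borel_measurable lebesgue; cbmo_norm p l b < \<infinity>\<rbrakk> \<Longrightarrow>
    ennreal (norm (ball_average b r - ball_average b (2 * r))) \<le> ennreal (A * r powr (real CARD('n) * l)) * cbmo_norm p l b"
proof -
  have p0: "0 < p $ i" for i
    using p[of i] by linarith
  let ?s = "\<Sum>i\<in>UNIV. 1 / p $ i" and ?n = "real CARD('n)"
  define v where "v = measure lebesgue (ball (0 :: real ^ 'n::{finite,linorder}) 1)"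
  have v: "0 < v" unfolding v_def by (rule measure_ball_0_pos) simp
  obtain C where C: "0 < C" "\<And>r b. 0 < r \<Longrightarrow>
      mixed_nn_norm p (\<lambda>x. ennreal (norm (b x - ball_average b r)) * indicator (ball 0 r) x)
      \<le> ennreal (C * r powr (?n * l + ?s)) * cbmo_norm p l b"
    by (rule cbmo_norm_bound[OF p0, where l = l]) blast
  show ?thesis
  proof (rule that[of "C * 2 powr (?n - ?s) * 2 powr (?n + ?n * l) / v"])
    fix r :: real and b :: "real ^ 'n::{finite,linorder} \<Rightarrow> complex"
    assume r: "0 < r" and [measurable]: "b \<in> borel_measurable lebesgue" and fin: "cbmo_norm p l b < \<infinity>"
    let ?c = "ball_average b (2 * r)"
    have r2: "0 < 2 * r" using r by simp
    have "(\<integral>\<^sup>+ t. ennreal (norm (b t - ?c)) * indicator (ball 0 r) t \<partial>lebesgue)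
        \<le> (\<integral>\<^sup>+ t. ennreal (norm (b t - ?c)) * indicator (ball 0 (2 * r)) t \<partial>lebesgue)"
      using r by (intro nn_integral_mono mult_left_mono) (auto simp: indicator_def)
    also have "\<dots> \<le> mixed_nn_norm p (\<lambda>t. ennreal (norm (b t - ?c)) * indicator (ball 0 (2 * r)) t)
        * ennreal (2 powr (?n - ?s) * (2 * r) powr (?n - ?s))"
      using p _ r2 by (rule nn_integral_ball_le_mixed_nn_norm) measurable
    also have "\<dots> \<le> ennreal (C * (2 * r) powr (?n * l + ?s)) * cbmo_norm p l b * ennreal (2 powr (?n - ?s) * (2 * r) powr (?n - ?s))"
      by (intro mult_right_mono C r2) simp
    also have "\<dots> = ennreal (C * (2 * r) powr (?n * l + ?s) * (2 powr (?n - ?s) * (2 * r) powr (?n - ?s))) * cbmo_norm p l b"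
      using C(1) by (simp add: ennreal_mult mult_ac)
    also have "C * (2 * r) powr (?n * l + ?s) * (2 powr (?n - ?s) * (2 * r) powr (?n - ?s))
        = C * 2 powr (?n - ?s) * (2 * r) powr (?n + ?n * l)"
    proof -
      have "(2 * r) powr (?n * l + ?s) * (2 * r) powr (?n - ?s) = (2 * r) powr (?n + ?n * l)"
        unfolding powr_add[symmetric] by (simp add: add.commute)
      then show ?thesis by (simp add: mult_ac)
    qed
    finally have mean: "(\<integral>\<^sup>+ t. ennreal (norm (b t - ?c)) * indicator (ball 0 r) t \<partial>lebesgue)
        \<le> ennreal (C * 2 powr (?n - ?s) * (2 * r) powr (?n + ?n * l)) * cbmo_norm p l b" .
    \<comment> \<open>Finiteness is what allows \<open>ball_average b r\<close> to be treated as a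
      convergent mean.\<close>
    also have "\<dots> < \<infinity>"
      using fin by (simp add: ennreal_mult_less_top)
    finally have "ennreal (norm (ball_average b r - ?c)) \<le> ennreal (1 / measure lebesgue (ball (0 :: real ^ 'n::{finite,linorder}) r))
        * (\<integral>\<^sup>+ t. ennreal (norm (b t - ?c)) * indicator (ball 0 r) t \<partial>lebesgue)"
      using r by (intro ball_average_diff_le) simp_all
    also have "\<dots> \<le> ennreal (1 / (v * r powr ?n)) * (ennreal (C * 2 powr (?n - ?s) * (2 * r) powr (?n + ?n * l)) * cbmo_norm p l b)"
      unfolding measure_ball_0[OF r] v_def[symmetric] by (intro mult_left_mono mean) simp
    also have "\<dots> = ennreal (1 / (v * r powr ?n) * (C * 2 powr (?n - ?s) * (2 * r) powr (?n + ?n * l))) * cbmo_norm p l b"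
      using v by (intro ennreal_mult_left) simp
    also have "1 / (v * r powr ?n) * (C * 2 powr (?n - ?s) * (2 * r) powr (?n + ?n * l))
        = C * 2 powr (?n - ?s) * 2 powr (?n + ?n * l) / v * r powr (?n * l)"
      using r v by (simp add: powr_mult powr_add[of r])
    finally show "ennreal (norm (ball_average b r - ?c))
      \<le> ennreal (C * 2 powr (?n - ?s) * 2 powr (?n + ?n * l) / v * r powr (?n * l)) * cbmo_norm p l b" .
  qed (use C v in simp)
qed

text \<open>Two Hoelder steps: \<open>p1\<close> and \<open>p2\<close> combine to \<open>q\<close>,
  and then \<open>q\<close> is paired with its conjugate on the ball, which exists because every
  \<open>q $ i\<close> exceeds 1.\<close>

lemma oscillation_holder_bound:
  fixes p1 p2 q :: "real ^ 'n::{finite,linorder}"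
  assumes pos: "\<And>i. 0 < p1 $ i" "\<And>i. 0 < p2 $ i" "\<And>i. 1 < q $ i"
    and exps: "\<And>i. 1 / q $ i = 1 / p1 $ i + 1 / p2 $ i"
  obtains A where "0 < A" and "\<And>r b f. \<lbrakk>0 < r; b \<in> borel_measurable lebesgue; f \<in> borel_measurable lebesgue\<rbrakk> \<Longrightarrow>
    (\<integral>\<^sup>+ t. ennreal (norm (b t - ball_average b r)) * ennreal (norm (f t)) * indicator (ball 0 r) t \<partial>lebesgue)
    \<le> ennreal (A * r powr (real CARD('n) + (real CARD('n) * l1 + real CARD('n) * l2)))
      * (cbmo_norm p2 l2 b * central_morrey_norm p1 l1 f)"
proof -
  have q0: "0 < q $ i" for i
    using pos(3)[of i] by linarith
  let ?s1 = "\<Sum>i\<in>UNIV. 1 / p1 $ i" and ?s2 = "\<Sum>i\<in>UNIV. 1 / p2 $ i" and ?s = "\<Sum>i\<in>UNIV. 1 / q $ i"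
    and ?n = "real CARD('n)"
  have s: "?s = ?s1 + ?s2" by (simp add: exps sum.distrib)
  obtain C1 where C1: "0 < C1" "\<And>r f. 0 < r \<Longrightarrow> mixed_nn_norm p1 (\<lambda>x. ennreal (norm (f x)) * indicator (ball 0 r) x)
      \<le> ennreal (C1 * r powr (?n * l1 + ?s1)) * central_morrey_norm p1 l1 f"
    by (rule central_morrey_norm_bound[OF pos(1), where l = l1]) blast
  obtain C2 where C2: "0 < C2" "\<And>r b. 0 < r \<Longrightarrow>
      mixed_nn_norm p2 (\<lambda>x. ennreal (norm (b x - ball_average b r)) * indicator (ball 0 r) x)
      \<le> ennreal (C2 * r powr (?n * l2 + ?s2)) * cbmo_norm p2 l2 b"
    by (rule cbmo_norm_bound[OF pos(2), where l = l2]) blast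
  show ?thesis
  proof (rule that[of "C1 * C2 * 2 powr (?n - ?s)"])
    fix r :: real and b f :: "real ^ 'n::{finite,linorder} \<Rightarrow> complex"
    assume r: "0 < r" and [measurable]: "b \<in> borel_measurable lebesgue" "f \<in> borel_measurable lebesgue"
    let ?b = "\<lambda>t. ennreal (norm (b t - ball_average b r))" and ?f = "\<lambda>t. ennreal (norm (f t))"
    let ?Kb = "cbmo_norm p2 l2 b" and ?Kf = "central_morrey_norm p1 l1 f"
    have "(\<lambda>t. ?b t * ?f t * indicator (ball 0 r) t)
        = (\<lambda>t. (?f t * indicator (ball 0 r) t) * (?b t * indicator (ball 0 r) t))"
      by (auto simp: fun_eq_iff indicator_def mult.commute)
    then have "mixed_nn_norm q (\<lambda>t. ?b t * ?f t * indicator (ball 0 r) t)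
        = mixed_nn_norm q (\<lambda>t. (?f t * indicator (ball 0 r) t) * (?b t * indicator (ball 0 r) t))"
      by (rule arg_cong)
    also have "\<dots> \<le> mixed_nn_norm p1 (\<lambda>t. ?f t * indicator (ball 0 r) t)
        * mixed_nn_norm p2 (\<lambda>t. ?b t * indicator (ball 0 r) t)"
      using q0 pos exps by (intro mixed_nn_norm_holder) auto
    also have "\<dots> \<le> (ennreal (C1 * r powr (?n * l1 + ?s1)) * ?Kf) * (ennreal (C2 * r powr (?n * l2 + ?s2)) * ?Kb)"
      by (intro mult_mono C1 C2 r) simp_all
    finally have norm_le: "mixed_nn_norm q (\<lambda>t. ?b t * ?f t * indicator (ball 0 r) t)
        \<le> (ennreal (C1 * r powr (?n * l1 + ?s1)) * ?Kf) * (ennreal (C2 * r powr (?n * l2 + ?s2)) * ?Kb)" .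
    have "(\<integral>\<^sup>+ t. ?b t * ?f t * indicator (ball 0 r) t \<partial>lebesgue)
        \<le> mixed_nn_norm q (\<lambda>t. ?b t * ?f t * indicator (ball 0 r) t) * ennreal (2 powr (?n - ?s) * r powr (?n - ?s))"
      using pos(3) _ r by (rule nn_integral_ball_le_mixed_nn_norm) measurable
    also have "\<dots> \<le> (ennreal (C1 * r powr (?n * l1 + ?s1)) * ?Kf) * (ennreal (C2 * r powr (?n * l2 + ?s2)) * ?Kb)
          * ennreal (2 powr (?n - ?s) * r powr (?n - ?s))"
      by (intro mult_right_mono norm_le) simp
    also have "\<dots> = ennreal (C1 * r powr (?n * l1 + ?s1) * (C2 * r powr (?n * l2 + ?s2)) * (2 powr (?n - ?s) * r powr (?n - ?s))) * (?Kb * ?Kf)"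
      using C1(1) C2(1) by (simp add: ennreal_mult mult_ac)
    also have "C1 * r powr (?n * l1 + ?s1) * (C2 * r powr (?n * l2 + ?s2)) * (2 powr (?n - ?s) * r powr (?n - ?s))
        = C1 * C2 * 2 powr (?n - ?s) * r powr (?n + (?n * l1 + ?n * l2))"
    proof -
      have "r powr (?n * l1 + ?s1) * r powr (?n * l2 + ?s2) * r powr (?n - ?s) = r powr (?n + (?n * l1 + ?n * l2))"
        unfolding powr_add[symmetric] s by (rule arg_cong[where f = "\<lambda>e. r powr e"]) simp
      then show ?thesis by (simp add: mult_ac)
    qed
    finally show "(\<integral>\<^sup>+ t. ?b t * ?f t * indicator (ball 0 r) t \<partial>lebesgue)
      \<le> ennreal (C1 * C2 * 2 powr (?n - ?s) * r powr (?n + (?n * l1 + ?n * l2))) * (?Kb * ?Kf)" .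
  qed (use C1 C2 in simp)
qed

text \<open>Hoelder's inequality with the indicator of the ball as the \<open>p1\<close> factor
  lowers the exponents from \<open>p2\<close> to \<open>q\<close>.\<close>

lemma oscillation_norm_bound:
  fixes p1 p2 q :: "real ^ 'n::{finite,linorder}"
  assumes pos: "\<And>i. 0 < p1 $ i" "\<And>i. 0 < p2 $ i" "\<And>i. 0 < q $ i"
    and exps: "\<And>i. 1 / q $ i = 1 / p1 $ i + 1 / p2 $ i"
  obtains B where "0 < B" and "\<And>r b. \<lbrakk>0 < r; b \<in> borel_measurable lebesgue\<rbrakk> \<Longrightarrow>
    mixed_nn_norm q (\<lambda>x. ennreal (norm (b x - ball_average b r)) * indicator (ball 0 r) x)
    \<le> ennreal (B * r powr (real CARD('n) * l + (\<Sum>i\<in>UNIV. 1 / q $ i))) * cbmo_norm p2 l b"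
proof -
  let ?s1 = "\<Sum>i\<in>UNIV. 1 / p1 $ i" and ?s2 = "\<Sum>i\<in>UNIV. 1 / p2 $ i" and ?s = "\<Sum>i\<in>UNIV. 1 / q $ i"
    and ?n = "real CARD('n)"
  have s: "?s = ?s1 + ?s2" by (simp add: exps sum.distrib)
  obtain C2 where C2: "0 < C2" "\<And>r b. 0 < r \<Longrightarrow>
      mixed_nn_norm p2 (\<lambda>x. ennreal (norm (b x - ball_average b r)) * indicator (ball 0 r) x)
      \<le> ennreal (C2 * r powr (?n * l + ?s2)) * cbmo_norm p2 l b"
    by (rule cbmo_norm_bound[OF pos(2), where l = l]) blast
  show ?thesis
  proof (rule that[of "2 powr ?s1 * C2"])
    fix r :: real and b :: "real ^ 'n::{finite,linorder} \<Rightarrow> complex"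
    assume r: "0 < r" and [measurable]: "b \<in> borel_measurable lebesgue"
    let ?b = "\<lambda>t. ennreal (norm (b t - ball_average b r))"
    have "(\<lambda>t. ?b t * indicator (ball 0 r) t) = (\<lambda>t. indicator (ball 0 r) t * (?b t * indicator (ball 0 r) t))"
      by (auto simp: fun_eq_iff indicator_def)
    then have "mixed_nn_norm q (\<lambda>t. ?b t * indicator (ball 0 r) t)
        = mixed_nn_norm q (\<lambda>t. indicator (ball 0 r) t * (?b t * indicator (ball 0 r) t))"
      by (rule arg_cong)
    also have "\<dots> \<le> mixed_nn_norm p1 (indicator (ball 0 r)) * mixed_nn_norm p2 (\<lambda>t. ?b t * indicator (ball 0 r) t)"
      using pos exps by (intro mixed_nn_norm_holder) auto
    also have "\<dots> \<le> ennreal (2 powr ?s1 * r powr ?s1) * (ennreal (C2 * r powr (?n * l + ?s2)) * cbmo_norm p2 l b)"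
      using pos(1) by (intro mult_mono C2 mixed_nn_norm_ball_le r) simp_all
    also have "\<dots> = ennreal (2 powr ?s1 * r powr ?s1 * (C2 * r powr (?n * l + ?s2))) * cbmo_norm p2 l b"
      by (intro ennreal_mult_left) simp
    also have "2 powr ?s1 * r powr ?s1 * (C2 * r powr (?n * l + ?s2)) = 2 powr ?s1 * C2 * r powr (?n * l + ?s)"
      by (simp add: s powr_add mult_ac)
    finally show "mixed_nn_norm q (\<lambda>x. ?b x * indicator (ball 0 r) x)
      \<le> ennreal (2 powr ?s1 * C2 * r powr (?n * l + ?s)) * cbmo_norm p2 l b" .
  qed (use C2 in simp)
qed

theorem theorem4p2:
  fixes p1 p2 q :: "real ^ 'n::{finite,linorder}"
    and l l1 l2 :: real
  assumes "\<And>i. 1 < p1 $ i"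
    and "\<And>i. 1 < q $ i"
    and "\<And>i. p1 $ i / (p1 $ i - 1) < p2 $ i"
    and "\<And>i. 1 / q $ i = 1 / p1 $ i + 1 / p2 $ i"
    and "- (1 / real CARD('n)) * (\<Sum>i\<in>UNIV. 1 / q $ i) < l" and "l < 0"
    and "0 \<le> l2" and "l2 < 1 / real CARD('n)"
    and "l = l1 + l2"
  shows "\<exists>C::real. C > 0 \<and>
    (\<forall>b \<in> cbmo_space p2 l2. \<forall>f \<in> central_morrey_space p1 l1.
       (\<forall>x. x \<noteq> 0 \<longrightarrow> dual_hardy_defined_at f x \<and> dual_hardy_defined_at (\<lambda>t. f t * b t) x) \<and>
       dual_hardy_commutator b f \<in> central_morrey_space q l \<and>
       central_morrey_norm q l (dual_hardy_commutator b f)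
         \<le> ennreal C * cbmo_norm p2 l2 b * central_morrey_norm p1 l1 f)"
proof -
  let ?n = "real CARD('n)" and ?s = "\<Sum>i\<in>UNIV. 1 / q $ i"
  let ?e1 = "?n * l1" and ?e2 = "?n * l2"
  \<comment> \<open>The conjugate exponent of \<open>p1 $ i\<close> exceeds 1, and
    \<open>p2 $ i\<close> exceeds the conjugate.\<close>
  have p2: "1 < p2 $ i" for i
  proof -
    have "1 < p1 $ i / (p1 $ i - 1)"
      using assms(1)[of i] by (simp add: field_simps)
    then show ?thesis using assms(3)[of i] by linarith
  qed
  have pos: "0 < p1 $ i" "0 < p2 $ i" "0 < q $ i" for i
    using assms(1,2)[of i] p2[of i] by linarith+
  have e: "?e1 + ?e2 = ?n * l"
    by (simp add: assms(9) distrib_left)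
  have e_neg: "?e1 + ?e2 < 0"
    unfolding e using assms(6) by (simp add: mult_pos_neg)
  have e2: "0 \<le> ?e2" using assms(7) by simp
  have e1_neg: "?e1 < 0" using e_neg e2 by linarith
  have e_pos: "0 < ?e1 + ?e2 + ?s"
    unfolding e using assms(5) by (simp add: field_simps)

  obtain A1 where A1: "0 < A1" "\<And>r f. \<lbrakk>0 < r; f \<in> borel_measurable lebesgue\<rbrakk> \<Longrightarrow>
      (\<integral>\<^sup>+ t. ennreal (norm (f t)) * indicator (ball 0 r) t \<partial>lebesgue)
      \<le> ennreal (A1 * r powr (?n + ?e1)) * central_morrey_norm p1 l1 f"
    by (rule central_morrey_mean_bound[OF assms(1), where l = l1]) blast
  obtain A2 where A2: "0 < A2" "\<And>r b. \<lbrakk>0 < r; b \<in> borel_measurable lebesgue; cbmo_norm p2 l2 b < \<infinity>\<rbrakk> \<Longrightarrow>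
      ennreal (norm (ball_average b r - ball_average b (2 * r))) \<le> ennreal (A2 * r powr ?e2) * cbmo_norm p2 l2 b"
    by (rule ball_average_doubling[OF p2, where l = l2]) blast
  obtain A3 where A3: "0 < A3" "\<And>r b f. \<lbrakk>0 < r; b \<in> borel_measurable lebesgue; f \<in> borel_measurable lebesgue\<rbrakk> \<Longrightarrow>
      (\<integral>\<^sup>+ t. ennreal (norm (b t - ball_average b r)) * ennreal (norm (f t)) * indicator (ball 0 r) t \<partial>lebesgue)
      \<le> ennreal (A3 * r powr (?n + (?e1 + ?e2))) * (cbmo_norm p2 l2 b * central_morrey_norm p1 l1 f)"
    by (rule oscillation_holder_bound[OF pos(1,2) assms(2,4), where ?l1.0 = l1 and ?l2.0 = l2]) blast
  \<comment> \<open>The combination lemma for oscillations takes a single constant for the mean, the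
    oscillation and the doubling step.\<close>
  define A where "A = A1 + A2 + A3"
  have A: "0 \<le> A" "A1 \<le> A" "A2 \<le> A" "A3 \<le> A"
    using A1(1) A2(1) A3(1) by (auto simp: A_def)
  obtain B0 where B0: "0 < B0" "\<And>r b. \<lbrakk>0 < r; b \<in> borel_measurable lebesgue\<rbrakk> \<Longrightarrow>
      mixed_nn_norm q (\<lambda>x. ennreal (norm (b x - ball_average b r)) * indicator (ball 0 r) x)
      \<le> ennreal (B0 * r powr (?e2 + ?s)) * cbmo_norm p2 l2 b"
    by (rule oscillation_norm_bound[OF pos assms(4), where l = l2]) blast
  define B where "B = B0 + 2 powr ?s"
  have B: "0 \<le> B" "B0 \<le> B" "2 powr ?s \<le> B"
    using B0(1) by (auto simp: B_def)
  obtain C3 where C3: "0 < C3" "\<And>r X K. \<lbrakk>0 < r; X \<le> ennreal (r powr (?n * l + ?s)) * K\<rbrakk>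
    \<Longrightarrow> X / (ennreal (measure lebesgue (ball (0 :: real ^ 'n::{finite,linorder}) r) powr l) * mixed_norm q (indicator (ball 0 r)))
      \<le> ennreal C3 * K"
    by (rule central_quotient_leI[OF pos(3), where l = l]) blast
  \<comment> \<open>The constants of the kernel estimate: \<open>T1\<close> for \<open>f\<close>
    with exponent \<open>?e1\<close>, and \<open>T2\<close> for the oscillation product with
    exponent \<open>?e1 + ?e2\<close> and the constant \<open>A + A^2\<close> produced by the
    drift.\<close>
  define T1 where "T1 = A * 2 ^ CARD('n) / (1 - 2 powr ?e1)\<^sup>2"
  define T2 where "T2 = (A + A\<^sup>2) * 2 ^ CARD('n) / (1 - 2 powr (?e1 + ?e2))\<^sup>2"
  define T where "T = T1 + T2"
  have T: "0 \<le> T" "T1 \<le> T" "T2 \<le> T"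
    using A(1) by (auto simp: T_def T1_def T2_def)
  define D where "D = 2 * T * B / (1 - 2 powr - (?e1 + ?e2 + ?s))"
  have "(2 :: real) powr - (?e1 + ?e2 + ?s) < 1"
    using e_pos by (intro powr_less_one) auto
  then have D: "0 \<le> D"
    using T(1) B(1) by (simp add: D_def)

  have main: "(\<forall>x. x \<noteq> 0 \<longrightarrow> dual_hardy_defined_at f x \<and> dual_hardy_defined_at (\<lambda>t. f t * b t) x)
      \<and> dual_hardy_commutator b f \<in> borel_measurable lebesgue
      \<and> central_morrey_norm q l (dual_hardy_commutator b f) \<le> ennreal (C3 * D) * (cbmo_norm p2 l2 b * central_morrey_norm p1 l1 f)"
    if "b \<in> cbmo_space p2 l2" "f \<in> central_morrey_space p1 l1" for b f
  proof -
    have [measurable]: "b \<in> borel_measurable lebesgue" "f \<in> borel_measurable lebesgue"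
      and fin: "cbmo_norm p2 l2 b < \<infinity>" "central_morrey_norm p1 l1 f < \<infinity>"
      using that by (auto simp: cbmo_space_def central_morrey_space_def)
    let ?\<beta> = "ball_average b" and ?Kb = "cbmo_norm p2 l2 b" and ?Kf = "central_morrey_norm p1 l1 f"
    let ?I = "\<lambda>r. \<integral>\<^sup>+ t. ennreal (norm (f t)) * dual_hardy_kernel (r / 2) t \<partial>lebesgue"
    let ?J = "\<lambda>r. \<integral>\<^sup>+ t. ennreal (norm (b t - ?\<beta> r)) * ennreal (norm (f t)) * dual_hardy_kernel (r / 2) t \<partial>lebesgue"
    have enlarge: "X \<le> ennreal (c' * r powr e) * K" if "X \<le> ennreal (c * r powr e) * K" "c \<le> c'" for X K c c' r e
      using that by (meson ennreal_leI mult_right_mono order_trans powr_ge_zero zero_le)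
    have mean: "(\<integral>\<^sup>+ t. ennreal (norm (f t)) * indicator (ball 0 r) t \<partial>lebesgue) \<le> ennreal (A * r powr (?n + ?e1)) * ?Kf"
      if "0 < r" for r
      using that A(2) by (intro enlarge[OF A1(2)]) measurable
    have osc: "(\<integral>\<^sup>+ t. ennreal (norm (b t - ?\<beta> r)) * ennreal (norm (f t)) * indicator (ball 0 r) t \<partial>lebesgue)
        \<le> ennreal (A * r powr (?n + (?e1 + ?e2))) * (?Kb * ?Kf)" if "0 < r" for r
      using that A(4) by (intro enlarge[OF A3(2)]) measurable
    have step: "ennreal (norm (?\<beta> r - ?\<beta> (2 * r))) \<le> ennreal (A * r powr ?e2) * ?Kb" if "0 < r" for r
      using that A(3) fin(1) by (intro enlarge[OF A2(2)]) measurable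
    have I: "?I r \<le> ennreal (T * r powr ?e1) * ?Kf" if r: "0 < r" for r
    proof (rule enlarge[OF _ T(2)], unfold T1_def, rule nn_integral_dual_hardy_kernel_le[OF _ r e1_neg A(1)])
      fix j
      \<comment> \<open>There is no drift in the integral of \<open>f\<close> alone; the factor
        \<open>j + 1\<close> is inserted only to fit the common kernel estimate.\<close>
      have "A \<le> A * real (Suc j)"
        using A(1) by (simp add: algebra_simps)
      then show "(\<integral>\<^sup>+ t. ennreal (norm (f t)) * indicator (ball 0 (r * 2 ^ j)) t \<partial>lebesgue)
          \<le> ennreal (A * real (Suc j) * (r * 2 ^ j) powr (?n + ?e1)) * ?Kf"
        using r by (intro enlarge[OF mean]) simp_all
    qed measurable
    have J: "?J r \<le> ennreal (T * r powr (?e1 + ?e2)) * (?Kb * ?Kf)" if r: "0 < r" for r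
    proof (rule enlarge[OF _ T(3)], unfold T2_def, rule nn_integral_dual_hardy_kernel_le[OF _ r e_neg])
      show "0 \<le> A + A\<^sup>2" using A(1) by simp
      show "(\<integral>\<^sup>+ t. ennreal (norm (b t - ?\<beta> r)) * ennreal (norm (f t)) * indicator (ball 0 (r * 2 ^ j)) t \<partial>lebesgue)
          \<le> ennreal ((A + A\<^sup>2) * real (Suc j) * (r * 2 ^ j) powr (?n + (?e1 + ?e2))) * (?Kb * ?Kf)" for j
        using _ _ A(1) e2 r mean osc step by (rule nn_integral_oscillation_le) measurable
    qed measurable
    have I_fin: "?I r < \<infinity>" and J_fin: "?J r < \<infinity>" if "0 < r" for r
      using I[OF that] J[OF that] fin by (auto simp: ennreal_mult_less_top intro: le_less_trans)
    have defined: "dual_hardy_defined_at f x \<and> dual_hardy_defined_at (\<lambda>t. f t * b t) x" if "x \<noteq> 0" for x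
    proof -
      \<comment> \<open>Every nonzero \<open>x\<close> lies on the inner edge of the shell with
        outer radius \<open>2 * norm x\<close>.\<close>
      have r: "0 < 2 * norm x" and x: "2 * norm x / 2 \<le> norm x"
        using that by simp_all
      show ?thesis
        using dual_hardy_commutator_norm_le(1,2)[OF _ _ I_fin[OF r] J_fin[OF r] x] by simp
    qed
    have point: "ennreal (norm (dual_hardy_commutator b f x))
        \<le> ennreal (norm (b x - ?\<beta> r)) * (ennreal (T * r powr ?e1) * ?Kf) + ennreal (T * r powr (?e1 + ?e2)) * (?Kb * ?Kf)"
      if r: "0 < r" and x: "r / 2 \<le> norm x" for r x
    proof -
      have "ennreal (norm (dual_hardy_commutator b f x)) \<le> ennreal (norm (b x - ?\<beta> r)) * ?I r + ?J r"
        using _ _ I_fin[OF r] J_fin[OF r] x by (rule dual_hardy_commutator_norm_le(3)) measurable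
      also have "\<dots> \<le> ennreal (norm (b x - ?\<beta> r)) * (ennreal (T * r powr ?e1) * ?Kf) + ennreal (T * r powr (?e1 + ?e2)) * (?Kb * ?Kf)"
        by (intro add_mono mult_left_mono I J r) simp
      finally show ?thesis .
    qed
    have [measurable]: "dual_hardy g \<in> borel_measurable lebesgue" if "g \<in> borel_measurable lebesgue" for g :: "real ^ 'n::{finite,linorder} \<Rightarrow> complex"
      using that by (rule borel_imp_lebesgue_measurable[OF borel_measurable_dual_hardy])
    have meas: "dual_hardy_commutator b f \<in> borel_measurable lebesgue"
      unfolding dual_hardy_commutator_def[abs_def] by measurable
    have "mixed_nn_norm q (\<lambda>x. ennreal (norm (dual_hardy_commutator b f x)) * indicator (ball 0 r) x)
        \<le> ennreal (D * r powr (?e1 + ?e2 + ?s)) * (?Kb * ?Kf)" if r: "0 < r" for r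
      unfolding D_def
    proof (rule mixed_nn_norm_dyadic_shells[OF assms(2) _ T(1) B(1) e_pos r point])
      show "mixed_nn_norm q (\<lambda>x. ennreal (norm (b x - ?\<beta> \<rho>)) * indicator (ball 0 \<rho>) x)
        \<le> ennreal (B * \<rho> powr (?e2 + ?s)) * ?Kb" if "0 < \<rho>" for \<rho>
        using that B(2) by (intro enlarge[OF B0(2)]) measurable
      show "mixed_nn_norm q (indicator (ball 0 \<rho>)) \<le> ennreal (B * \<rho> powr ?s)" if "0 < \<rho>" for \<rho>
        using enlarge[of _ "2 powr ?s" \<rho> ?s 1 B] mixed_nn_norm_ball_le[OF pos(3) that] B(3) by simp
    qed measurable
    then have "mixed_norm q (\<lambda>x. dual_hardy_commutator b f x * indicator (ball 0 r) x)
        \<le> ennreal (r powr (?n * l + ?s)) * (ennreal D * (?Kb * ?Kf))" if "0 < r" for r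
      using that D unfolding mixed_norm_eq norm_mult_indicator e
      by (simp add: ennreal_mult_left mult.commute[of "r powr _"])
    then have "central_morrey_norm q l (dual_hardy_commutator b f) \<le> ennreal C3 * (ennreal D * (?Kb * ?Kf))"
      unfolding central_morrey_norm_def by (intro SUP_least C3(2)) simp_all
    also have "\<dots> = ennreal (C3 * D) * (?Kb * ?Kf)"
      using C3(1) by (intro ennreal_mult_left) simp
    finally show ?thesis
      using defined meas by blast
  qed
  show ?thesis
  \<comment> \<open>\<open>D\<close> is only known to be nonnegative; the added 1 makes the constant
    positive.\<close>
  proof (intro exI[of _ "C3 * D + 1"] conjI ballI)
    show "0 < C3 * D + 1" using C3(1) D by (simp add: add_nonneg_pos)
    fix b f
    assume b: "b \<in> cbmo_space p2 l2" and f: "f \<in> central_morrey_space p1 l1"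
    let ?K = "cbmo_norm p2 l2 b * central_morrey_norm p1 l1 f"
    note m = main[OF b f]
    show "\<forall>x. x \<noteq> 0 \<longrightarrow> dual_hardy_defined_at f x \<and> dual_hardy_defined_at (\<lambda>t. f t * b t) x"
      using m by blast
    have "ennreal (C3 * D) * ?K < \<infinity>"
      using b f by (simp add: cbmo_space_def central_morrey_space_def ennreal_mult_less_top)
    with m show "dual_hardy_commutator b f \<in> central_morrey_space q l"
      unfolding central_morrey_space_def by (auto intro: le_less_trans)
    have "ennreal (C3 * D) * ?K \<le> ennreal (C3 * D + 1) * ?K"
      by (intro mult_right_mono ennreal_leI) simp_all
    with m show "central_morrey_norm q l (dual_hardy_commutator b f)
        \<le> ennreal (C3 * D + 1) * cbmo_norm p2 l2 b * central_morrey_norm p1 l1 f"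
      unfolding mult.assoc by (meson order_trans)
  qed
qed

end
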